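(* Let $\delta>0$, $0<\alpha<2$ and $\beta\in\mathbb{C}$, and let $\epsilon>0$ and $\mu$ be given such that $$\frac{\pi\alpha}{2}<\mu<\min\{\pi,\alpha\pi\}.$$ Then for $z\in G^-(\epsilon,\mu)$, $$E^\delta_{\alpha,\beta}(z)=\frac{1}{2\pi\alpha i}\int_{\gamma(\epsilon,\mu)}\frac{\exp\left(\zeta^{1/\alpha}\right)\zeta^{\frac{1-\beta}{\alpha}+\delta-1}}{(\zeta-z)^\delta}\,d\zeta,$$ and, in case $\delta$ is a positive integer, for $z\in G^+(\epsilon,\mu)$, $$E^\delta_{\alpha,\beta}(z)=\frac{1}{2\pi\alpha i}\int_{\gamma(\epsilon,\mu)}\frac{\exp\left(\zeta^{1/\alpha}\right)\zeta^{\frac{1-\beta}{\alpha}+\delta-1}}{(\zeta-z)^\delta}\,d\zeta+\frac{1}{\alpha\,\Gamma(\delta)}\frac{d^{\delta-1}}{dz^{\delta-1}}g(z),$$ where $g(z)=\exp(z^{1/\alpha})\,z^{(1-\beta)/\alpha+\delta-1}$.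
   Context: The Prabhakar generalized Mittag-Leffler function is $E^\delta_{\alpha,\beta}(z)=\sum_{n=0}^\infty\frac{(\delta)_n}{n!\,\Gamma(\alpha n+\beta)}z^n$ for $\mathrm{Re}\,\alpha>0$, where $(\delta)_n=\delta(\delta+1)\cdots(\delta+n-1)$. For $\epsilon>0$ and $0<\mu<\pi$, the contour $\gamma(\epsilon,\mu)$ consists of the arc $\{\zeta\in\mathbb{C}:|\zeta|=\epsilon,\ |\arg\zeta|\le\mu\}$ and the two rays $\{\zeta\in\mathbb{C}:|\zeta|\ge\epsilon,\ \arg\zeta=\pm\mu\}$, oriented so that $\arg\zeta$ is non-decreasing (coming from infinity along the ray $\arg\zeta=-\mu$, along the arc, and out to infinity along the ray $\arg\zeta=\mu$). It divides the complex plane into two open regions: $G^-(\epsilon,\mu)$ to the left of the contour (containing $0$ and the negative real axis) and $G^+(\epsilon,\mu)=\{z:|z|>\epsilon,\ |\arg z|<\mu\}$ to the right. Complex powers are taken with branch cut along the negative real axis (principal branch, $\arg\in(-\pi,\pi)$); for non-integer $\delta$ the factor $\zeta^{\delta}/(\zeta-z)^{\delta}$ in the integrand means $(1-z/\zeta)^{-\delta}$ with the principal branch, which is well-defined for $\zeta\in\gamma(\epsilon,\mu)$ and $z\in G^-(\epsilon,\mu)$. *)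

theory Defs
  imports "HOL-Complex_Analysis.Complex_Analysis"
begin

text \<open>
  The Prabhakar function. The entire function \<^term>\<open>rGamma\<close> is the reciprocal Gamma function,
  so terms in which \<open>\<alpha> n + \<beta>\<close> is a pole of Gamma vanish.
\<close>

definition prabhakar :: "complex \<Rightarrow> complex \<Rightarrow> complex \<Rightarrow> complex \<Rightarrow> complex" where
  "prabhakar \<alpha> \<beta> \<delta> z =
     (\<Sum>n. pochhammer \<delta> n / fact n * rGamma (\<alpha> * of_nat n + \<beta>) * z ^ n)"

definition gamma_contour :: "real \<Rightarrow> real \<Rightarrow> complex set" where
  "gamma_contour \<epsilon> \<mu> =
     {\<zeta>. norm \<zeta> = \<epsilon> \<and> \<bar>Arg \<zeta>\<bar> \<le> \<mu>} \<union> {\<zeta>. norm \<zeta> \<ge> \<epsilon> \<and> \<bar>Arg \<zeta>\<bar> = \<mu>}"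

definition G_plus :: "real \<Rightarrow> real \<Rightarrow> complex set" where
  "G_plus \<epsilon> \<mu> = {z. norm z > \<epsilon> \<and> \<bar>Arg z\<bar> < \<mu>}"

text \<open>The rest of the plane off the contour; by the lemma \<open>G_minus_eq\<close> it contains the disc
  around 0 and everything with argument beyond \<open>\<mu>\<close>.\<close>

definition G_minus :: "real \<Rightarrow> real \<Rightarrow> complex set" where
  "G_minus \<epsilon> \<mu> = - (gamma_contour \<epsilon> \<mu> \<union> G_plus \<epsilon> \<mu>)"

lemma G_minus_eq: "G_minus \<epsilon> \<mu> = {z. norm z < \<epsilon> \<or> \<bar>Arg z\<bar> > \<mu>}"
  by (auto simp: G_minus_def gamma_contour_def G_plus_def)

text \<open>
  The integral along the unbounded contour. The two rays are parametrised by the modulus and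
  carry Lebesgue integrals, so that integrability means absolute convergence at infinity;
  the sign of the first term reflects that the lower ray is traversed towards 0.
\<close>

definition gamma_integrable :: "real \<Rightarrow> real \<Rightarrow> (complex \<Rightarrow> complex) \<Rightarrow> bool" where
  "gamma_integrable \<epsilon> \<mu> f \<longleftrightarrow>
     set_integrable lborel {\<epsilon>..} (\<lambda>r. f (of_real r * cis (- \<mu>))) \<and>
     f contour_integrable_on (part_circlepath 0 \<epsilon> (- \<mu>) \<mu>) \<and>
     set_integrable lborel {\<epsilon>..} (\<lambda>r. f (of_real r * cis \<mu>))"

definition gamma_integral :: "real \<Rightarrow> real \<Rightarrow> (complex \<Rightarrow> complex) \<Rightarrow> complex" where
  "gamma_integral \<epsilon> \<mu> f =
     - (cis (- \<mu>) * (LBINT r:{\<epsilon>..}. f (of_real r * cis (- \<mu>))))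
     + contour_integral (part_circlepath 0 \<epsilon> (- \<mu>) \<mu>) f
     + cis \<mu> * (LBINT r:{\<epsilon>..}. f (of_real r * cis \<mu>))"

lemma gamma_contour_eq_pieces:
  assumes "0 < \<epsilon>" "0 < \<mu>" "\<mu> < pi"
  shows "gamma_contour \<epsilon> \<mu> =
           (\<lambda>r. of_real r * cis (- \<mu>)) ` {\<epsilon>..} \<union>
           path_image (part_circlepath 0 \<epsilon> (- \<mu>) \<mu>) \<union>
           (\<lambda>r. of_real r * cis \<mu>) ` {\<epsilon>..}"
proof -
  have arg: "Arg (of_real r * cis t) = t" "norm (of_real r * cis t) = r"
    if "r > 0" "\<bar>t\<bar> \<le> \<mu>" for r t
    proof -
    have "t \<in> {- pi<..pi}" using that assms by auto
    then show "Arg (of_real r * cis t) = t" "norm (of_real r * cis t) = r"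
      using that by (simp_all add: norm_mult Arg_cis)
  qed
  have pol: "\<zeta> = of_real (norm \<zeta>) * cis (Arg \<zeta>)" for \<zeta> :: complex
    by (metis rcis_cmod_Arg rcis_def)
  have arc: "path_image (part_circlepath 0 \<epsilon> (- \<mu>) \<mu>) =
               (\<lambda>t. of_real \<epsilon> * cis t) ` {- \<mu>..\<mu>}"
    using assms by (auto simp: path_image_part_circlepath cis_conv_exp)
  show ?thesis (is "?L = ?R")
  proof (intro equalityI subsetI)
    fix \<zeta> assume "\<zeta> \<in> ?L"
    then consider "norm \<zeta> = \<epsilon>" "\<bar>Arg \<zeta>\<bar> \<le> \<mu>" | "norm \<zeta> \<ge> \<epsilon>" "Arg \<zeta> = \<mu>" | "norm \<zeta> \<ge> \<epsilon>" "Arg \<zeta> = - \<mu>"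
      by (auto simp: gamma_contour_def abs_if split: if_splits)
    then show "\<zeta> \<in> ?R"
    proof cases
      case 1
      then have "\<zeta> = of_real \<epsilon> * cis (Arg \<zeta>)" "Arg \<zeta> \<in> {- \<mu>..\<mu>}" using pol[of \<zeta>] by auto
      then show ?thesis unfolding arc by blast
    next
      case 2
      then have "\<zeta> = of_real (norm \<zeta>) * cis \<mu>" "norm \<zeta> \<in> {\<epsilon>..}" using pol[of \<zeta>] by auto
      then show ?thesis by blast
    next
      case 3
      then have "\<zeta> = of_real (norm \<zeta>) * cis (- \<mu>)" "norm \<zeta> \<in> {\<epsilon>..}" using pol[of \<zeta>] by auto
      then show ?thesis by blast
    qed
  next
    fix \<zeta> assume "\<zeta> \<in> ?R"
    then consider r where "\<zeta> = of_real r * cis (- \<mu>)" "r \<ge> \<epsilon>"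
      | t where "\<zeta> = of_real \<epsilon> * cis t" "\<bar>t\<bar> \<le> \<mu>"
      | r where "\<zeta> = of_real r * cis \<mu>" "r \<ge> \<epsilon>"
      unfolding arc by fastforce
    then show "\<zeta> \<in> ?L"
    proof cases
      case 1
      then show ?thesis using arg[of r "- \<mu>"] assms by (simp add: gamma_contour_def)
    next
      case 2
      then show ?thesis using arg[of \<epsilon> t] assms by (simp add: gamma_contour_def)
    next
      case 3
      then show ?thesis using arg[of r \<mu>] assms by (simp add: gamma_contour_def)
    qed
  qed
qed

definition prabhakar_g :: "real \<Rightarrow> complex \<Rightarrow> real \<Rightarrow> complex \<Rightarrow> complex" where
  "prabhakar_g \<alpha> \<beta> \<delta> z =
     exp (z powr (1 / of_real \<alpha>)) * z powr ((1 - \<beta>) / of_real \<alpha> + of_real \<delta> - 1)"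

text \<open>
  The integrand \<open>exp (\<zeta>\<^bsup>1/\<alpha>\<^esup>) \<zeta>\<^bsup>(1-\<beta>)/\<alpha>+\<delta>-1\<^esup> / (\<zeta> - z)\<^bsup>\<delta>\<^esup>\<close>, where the factor
  \<open>\<zeta>\<^bsup>\<delta>\<^esup> / (\<zeta> - z)\<^bsup>\<delta>\<^esup>\<close> is understood as \<open>(1 - z/\<zeta>)\<^bsup>-\<delta>\<^esup>\<close> with the principal branch. (A literal
  principal-branch reading of \<open>(\<zeta> - z)\<^bsup>\<delta>\<^esup>\<close> would jump along the contour.) For integer \<open>\<delta>\<close>
  this is the literal quotient, see \<open>prabhakar_integrand_of_nat\<close>.
\<close>

definition prabhakar_integrand ::
    "real \<Rightarrow> complex \<Rightarrow> real \<Rightarrow> complex \<Rightarrow> complex \<Rightarrow> complex" where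
  "prabhakar_integrand \<alpha> \<beta> \<delta> z \<zeta> =
     exp (\<zeta> powr (1 / of_real \<alpha>)) * \<zeta> powr ((1 - \<beta>) / of_real \<alpha> - 1)
       * (1 - z / \<zeta>) powr (- of_real \<delta>)"

lemma prabhakar_integrand_of_nat:
  assumes "\<zeta> \<noteq> 0" "\<zeta> \<noteq> z"
  shows "prabhakar_integrand \<alpha> \<beta> (of_nat n) z \<zeta> =
           exp (\<zeta> powr (1 / of_real \<alpha>)) * \<zeta> powr ((1 - \<beta>) / of_real \<alpha> + of_nat n - 1)
             / (\<zeta> - z) ^ n"
proof -
  have "1 - z / \<zeta> \<noteq> 0" using assms by (simp add: field_simps)
  then have "(1 - z / \<zeta>) powr (- of_nat n) = inverse ((1 - z / \<zeta>) ^ n)"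
    by (simp add: powr_minus powr_nat')
  moreover have "1 - z / \<zeta> = (\<zeta> - z) / \<zeta>" using assms by (simp add: field_simps)
  ultimately have 1: "(1 - z / \<zeta>) powr (- of_nat n) = \<zeta> ^ n / (\<zeta> - z) ^ n"
    by (simp add: power_divide)
  have "\<zeta> powr ((1 - \<beta>) / of_real \<alpha> + of_nat n - 1)
      = \<zeta> powr ((1 - \<beta>) / of_real \<alpha> - 1 + of_nat n)" by (simp add: algebra_simps)
  also have "\<dots> = \<zeta> powr ((1 - \<beta>) / of_real \<alpha> - 1) * \<zeta> ^ n"
    using assms by (simp only: powr_add) (simp add: powr_nat')
  finally show ?thesis using 1 by (simp add: prabhakar_integrand_def)
qed

end

theory Submission
  imports Defs "HOL-Real_Asymp.Real_Asymp"
begin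

text \<open>
  The representation rests on Hankel's formula
  \<open>1/\<Gamma>(b) = 1/(2 \<pi> \<i>) \<integral> e\<^sup>u u\<^sup>-\<^sup>b du\<close>, where the contour consists of two rays at angles \<open>\<plusminus> t\<close> with
  \<open>\<pi>/2 < t < \<pi>\<close>, joined by an arc around 0 (\<open>hairpin_hankel\<close>). The substitution \<open>\<zeta> = u\<^sup>\<alpha>\<close> turns this contour
  into \<open>\<gamma>(\<epsilon>, \<mu>)\<close> with \<open>\<mu> = \<alpha> t\<close>, and the hypothesis \<open>\<pi> \<alpha> / 2 < \<mu> < \<alpha> \<pi>\<close> is the condition on \<open>t\<close>.

  If \<open>\<bar>z\<bar> < \<epsilon>\<close>, then the factor \<open>(1 - z / \<zeta>)\<^sup>-\<^sup>\<delta>\<close> is expanded in its binomial series on the contour; integrating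
  term by term with Hankel's formula gives the Prabhakar series (\<open>prabhakar_hairpin\<close>). For any other \<open>z\<close>,
  this gives the formula on a contour with an arc of radius \<open>\<epsilon>' > \<bar>z\<bar>\<close>, and it remains to compare the two
  contours. They differ by the boundary of the annular sector
  \<open>\<epsilon> < \<bar>\<zeta>\<bar> < \<epsilon>'\<close>, \<open>\<bar>Arg \<zeta>\<bar> < \<mu>\<close> (\<open>hairpin_shift\<close>). For \<open>z\<close> to the left of the contour the integrand is holomorphic
  there and Cauchy's theorem makes the difference vanish (\<open>prabhakar_G_minus\<close>). For \<open>z\<close> to the right and integer
  \<open>\<delta>\<close> it has one pole, of order \<open>\<delta>\<close> at \<open>z\<close>, whose residue is \<open>g\<^sup>(\<^sup>\<delta>\<^sup>-\<^sup>1\<^sup>)(z) / (\<delta> - 1)!\<close>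
  (\<open>prabhakar_G_plus\<close>).

  Hankel's formula is first proved for \<open>Re b < 1\<close>. There the arc can be shrunk to 0, the two rays become
  Laplace integrals of \<open>x\<^sup>-\<^sup>b\<close>, and the reflection formula for \<open>\<Gamma>\<close> finishes the computation. Integration by parts
  and continuity at \<open>b = 1\<close> extend it to all \<open>b\<close>.

  Everything is carried out in the logarithmic coordinate \<open>w = ln \<zeta>\<close>, where \<open>\<gamma>(\<epsilon>, \<mu>)\<close> becomes a hairpin made of
  three straight pieces, the power functions have no branch cuts, and annular sectors become rectangles.
\<close>

section \<open>Integrals over real sets\<close>

lemma absolutely_integrable_continuous_bound:
  fixes f :: "real \<Rightarrow> complex" and g :: "real \<Rightarrow> real"
  assumes "continuous_on S f" "S \<in> sets lebesgue" "g integrable_on S"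
    and "\<And>x. x \<in> S \<Longrightarrow> norm (f x) \<le> g x"
  shows "f absolutely_integrable_on S"
  using assms by (intro measurable_bounded_by_integrable_imp_absolutely_integrable
      continuous_imp_measurable_on_sets_lebesgue)

text \<open>
  Used twice: to let a ray \<open>[a, n]\<close> grow to infinity, and to let its starting point \<open>- n\<close> recede.
\<close>

lemma integral_tendsto_exhaustion:
  fixes f :: "real \<Rightarrow> complex"
  assumes f: "f absolutely_integrable_on S"
    and sub: "\<And>k. T k \<subseteq> S" and meas: "\<And>k. T k \<in> sets lebesgue"
    and ev: "\<And>x. x \<in> S \<Longrightarrow> eventually (\<lambda>k. x \<in> T k) sequentially"
  shows "(\<lambda>k. integral (T k) f) \<longlonglongrightarrow> integral S f"
proof -
  let ?g = "\<lambda>k x. if x \<in> T k then f x else 0"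
  have int: "f integrable_on T k" for k
    using set_integrable_subset[OF f, of "T k"] sub meas
    by (auto intro: set_lebesgue_integral_eq_integral(1))
  have eq: "integral S (?g k) = integral (T k) f" for k
    using sub[of k] by (simp add: integral_restrict_Int inf.absorb1 Int_commute inf.absorb2)
  have "(\<lambda>k. integral S (?g k)) \<longlonglongrightarrow> integral S f"
  proof (rule dominated_convergence(2)[where h = "\<lambda>x. norm (f x)"])
    show "?g k integrable_on S" for k
      using int[of k] sub[of k] by (simp add: integrable_restrict_Int Int_commute inf.absorb1 inf.absorb2)
    show "(\<lambda>x. norm (f x)) integrable_on S"
      using f by (simp add: absolutely_integrable_on_def)
    show "(\<lambda>k. ?g k x) \<longlonglongrightarrow> f x" if "x \<in> S" for x
      by (rule tendsto_eventually, rule eventually_mono[OF ev[OF that]]) simp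
  qed auto
  then show ?thesis by (simp add: eq)
qed

lemma integral_tendsto_dominated:
  fixes f :: "nat \<Rightarrow> real \<Rightarrow> complex"
  assumes f: "\<And>n. f n absolutely_integrable_on S"
    and k: "k absolutely_integrable_on S"
    and lim: "\<And>x. x \<in> S \<Longrightarrow> (\<lambda>n. f n x) \<longlonglongrightarrow> g x"
    and bound: "\<And>n x. x \<in> S \<Longrightarrow> norm (f n x) \<le> C * norm (k x :: complex)"
  shows "g absolutely_integrable_on S" "(\<lambda>n. integral S (f n)) \<longlonglongrightarrow> integral S g"
proof -
  let ?h = "\<lambda>x. C * norm (k x)"
  have fi: "f n integrable_on S" for n using f by (rule set_lebesgue_integral_eq_integral)
  have h: "?h integrable_on S" using k by (intro integrable_on_mult_right) (simp add: absolutely_integrable_on_def)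
  have g: "g integrable_on S" by (rule dominated_convergence(1)[OF fi h bound lim])
  show "(\<lambda>n. integral S (f n)) \<longlonglongrightarrow> integral S g"
    by (rule dominated_convergence(2)[OF fi h bound lim])
  have "norm (g x) \<le> ?h x" if "x \<in> S" for x
    using bound[OF that] by (intro LIMSEQ_le_const2[OF tendsto_norm[OF lim[OF that]]]) auto
  then show "g absolutely_integrable_on S"
    by (rule absolutely_integrable_integrable_bound[OF _ g h])
qed

text \<open>
  The fundamental theorem of calculus on a half-line, for a primitive that vanishes at infinity.
\<close>

lemma integral_from_to_infinity:
  fixes F f :: "real \<Rightarrow> complex"
  assumes f: "f absolutely_integrable_on {a..}"
    and F: "\<And>x. a \<le> x \<Longrightarrow> (F has_vector_derivative f x) (at x)"
    and lim: "(F \<longlongrightarrow> 0) at_top"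
  shows "integral {a..} f = - F a"
proof -
  have "(\<lambda>k. integral {a..real k} f) \<longlonglongrightarrow> integral {a..} f"
  proof (rule integral_tendsto_exhaustion[OF f])
    show "\<forall>\<^sub>F k in sequentially. x \<in> {a..real k}" if "x \<in> {a..}" for x
      using that eventually_ge_at_top[of "nat \<lceil>x\<rceil>"] by (elim eventually_rev_mp) (auto intro!: always_eventually simp: nat_ceiling_le_eq)
  qed auto
  moreover have "(\<lambda>k. integral {a..real k} f) \<longlonglongrightarrow> 0 - F a"
  proof (rule Lim_transform_eventually)
    show "(\<lambda>k. F (real k) - F a) \<longlonglongrightarrow> 0 - F a"
      using filterlim_compose[OF lim filterlim_real_sequentially] by (intro tendsto_intros)
    show "\<forall>\<^sub>F k in sequentially. F (real k) - F a = integral {a..real k} f"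
      using eventually_ge_at_top[of "nat \<lceil>a\<rceil>"]
    proof eventually_elim
      case (elim k)
      then have "a \<le> real k" by (simp add: nat_ceiling_le_eq)
      then show ?case using F
        by (intro integral_unique[symmetric] fundamental_theorem_of_calculus)
           (auto intro: has_vector_derivative_at_within)
    qed
  qed
  ultimately show ?thesis using LIMSEQ_unique by fastforce
qed

section \<open>Two Laplace integrals\<close>

text \<open>
  Euler's integral \<open>\<integral> t\<^sup>s\<^sup>-\<^sup>1 e\<^sup>-\<^sup>t dt\<close> over the positive axis, after the substitution \<open>t = a e\<^sup>x\<close>. In the
  variable \<open>x\<close> the complex power becomes an exponential.
\<close>

lemma
  assumes "Re s > 0" "a > 0"
  shows Gamma_integral_exp_absolutely_integrable:
      "(\<lambda>x. exp (s * of_real x - of_real (a * exp x))) absolutely_integrable_on UNIV"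
    and Gamma_integral_exp:
      "integral UNIV (\<lambda>x. exp (s * of_real x - of_real (a * exp x))) = Gamma s * of_real a powr (- s)"
proof -
  let ?f = "\<lambda>t. complex_of_real t powr (s - 1) / of_real (exp t)"
  have im: "range (\<lambda>x. a * exp x) = {0<..}"
  proof (intro equalityI subsetI)
    fix y :: real assume "y \<in> {0<..}"
    then have "y = a * exp (ln (y / a))" using assms by simp
    then show "y \<in> range (\<lambda>x. a * exp x)" by blast
  qed (use assms in auto)
  have "?f absolutely_integrable_on {0<..}"
    by (rule absolutely_integrable_Gamma_integral') fact
  moreover have "integral {0<..} ?f = Gamma s"
    using Gamma_integral_complex'[OF assms(1)] by (rule integral_unique)
  ultimately have A: "(\<lambda>x. \<bar>a * exp x\<bar> *\<^sub>R ?f (a * exp x)) absolutely_integrable_on UNIV \<and>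
      integral UNIV (\<lambda>x. \<bar>a * exp x\<bar> *\<^sub>R ?f (a * exp x)) = Gamma s"
    unfolding im[symmetric] using assms
    by (subst has_absolute_integral_change_of_variables_real)
       (auto intro!: derivative_eq_intros injI)
  have B: "\<bar>a * exp x\<bar> *\<^sub>R ?f (a * exp x) = of_real a powr s * exp (s * of_real x - of_real (a * exp x))" for x
  proof -
    have p: "a * exp x > 0" using assms by simp
    have "\<bar>a * exp x\<bar> *\<^sub>R ?f (a * exp x) = of_real (a * exp x) powr s / of_real (exp (a * exp x))"
      using p by (simp add: powr_diff scaleR_conv_of_real)
    also have "of_real (a * exp x) powr s = exp (s * of_real (ln (a * exp x)))"
      using p assms by (simp only: powr_def Ln_of_real) simp
    also have "ln (a * exp x) = ln a + x" using assms by (simp add: ln_mult)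
    also have "exp (s * of_real (ln a + x)) = of_real a powr s * exp (s * of_real x)"
      using assms by (simp add: powr_def Ln_of_real exp_add ring_distribs)
    finally show ?thesis by (simp only: exp_diff exp_of_real times_divide_eq_right)
  qed
  have C: "of_real a powr s \<noteq> 0" using assms by simp
  show "(\<lambda>x. exp (s * of_real x - of_real (a * exp x))) absolutely_integrable_on UNIV"
    using A C unfolding B by simp
  have "of_real a powr s * integral UNIV (\<lambda>x. exp (s * of_real x - of_real (a * exp x))) = Gamma s"
    using A unfolding B by simp
  then show "integral UNIV (\<lambda>x. exp (s * of_real x - of_real (a * exp x))) = Gamma s * of_real a powr (- s)"
    using C by (simp add: powr_minus field_simps)
qed

lemma laplace_absolutely_integrable:
  assumes "Re s > 0" "Re c > 0"
  shows "(\<lambda>x. exp (s * of_real x - c * of_real (exp x))) absolutely_integrable_on UNIV"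
proof (rule absolutely_integrable_continuous_bound)
  show "(\<lambda>x. norm (exp (of_real (Re s) * of_real x - complex_of_real (Re c * exp x)))) integrable_on UNIV"
    using Gamma_integral_exp_absolutely_integrable[of "of_real (Re s)" "Re c"] assms
    by (simp add: absolutely_integrable_on_def)
qed (auto intro!: continuous_intros)

lemma binomial_series_neg:
  fixes s q :: complex
  assumes "cmod q < 1"
  shows "(\<lambda>n. pochhammer s n / fact n * q ^ n) sums (1 - q) powr (- s)"
proof -
  have "(- s gchoose n) * (- q) ^ n = pochhammer s n / fact n * q ^ n" for n
  proof -
    have "(- s gchoose n) * (- q) ^ n = pochhammer s n / fact n * ((- 1) ^ n * (- q) ^ n)"
      by (simp add: gbinomial_pochhammer)
    also have "(- 1) ^ n * (- q) ^ n = q ^ n" by (simp only: power_mult_distrib[symmetric]) simp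
    finally show ?thesis .
  qed
  then show ?thesis using gen_binomial_complex[of "- q" "- s"] assms by simp
qed

text \<open>
  The same integral with a complex rate \<open>c\<close>, which would usually be obtained by rotating the path of
  integration. Here \<open>exp (- c e\<^sup>x)\<close> is expanded around a real rate \<open>a\<close>, as \<open>exp (- a e\<^sup>x)\<close> times the
  exponential series in \<open>(a - c) e\<^sup>x\<close>. Termwise integration gives \<open>\<Gamma>(s) a\<^sup>-\<^sup>s\<close> times the binomial series
  of \<open>(1 - (a - c) / a)\<^sup>-\<^sup>s = (c / a)\<^sup>-\<^sup>s\<close>. All of this converges once \<open>\<bar>a - c\<bar> < a\<close>, and every large
  \<open>a\<close> satisfies this because \<open>c\<close> lies in the right half-plane.
\<close>

lemma laplace_integral:
  assumes "Re s > 0" "Re c > 0"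
  shows "integral UNIV (\<lambda>x. exp (s * of_real x - c * of_real (exp x))) = Gamma s * c powr (- s)"
proof -
  \<comment> \<open>The square of \<open>\<bar>a - c\<bar>\<close> is \<open>a\<^sup>2 - 2 a Re c + \<bar>c\<bar>\<^sup>2\<close>, so any \<open>a > \<bar>c\<bar>\<^sup>2 / (2 Re c)\<close> would do.\<close>
  define a where "a = (cmod c)\<^sup>2 / Re c"
  have cnz: "c \<noteq> 0" using assms by auto
  have a: "a > 0" unfolding a_def using assms cnz by simp
  have ac: "cmod (of_real a - c) < a"
  proof -
    have "(cmod (of_real a - c))\<^sup>2 = a\<^sup>2 - 2 * (a * Re c) + (cmod c)\<^sup>2"
      unfolding cmod_power2 by (simp add: power2_eq_square algebra_simps)
    also have "a * Re c = (cmod c)\<^sup>2" using assms by (simp add: a_def)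
    finally have "(cmod (of_real a - c))\<^sup>2 < a\<^sup>2" using cnz by simp
    then show ?thesis using a by (simp add: power_less_imp_less_base)
  qed
  define u where "u = of_real a - c"
  define f where "f n x = u ^ n / fact n * exp ((s + of_nat n) * of_real x - of_real (a * exp x))" for n x
  have If: "integral UNIV (f n) = Gamma s * of_real a powr (- s) * (pochhammer s n / fact n * (u / of_real a) ^ n)"
    and fi: "f n absolutely_integrable_on UNIV" for n
  proof -
    have sn: "Re (s + of_nat n) > 0" using assms by (simp add: add_pos_nonneg)
    have "s \<notin> \<int>\<^sub>\<le>\<^sub>0" using assms by (auto elim!: nonpos_Ints_cases)
    then have "Gamma (s + of_nat n) = pochhammer s n * Gamma s"
      by (simp add: pochhammer_Gamma Gamma_eq_zero_iff)
    moreover have "of_real a powr (- (s + of_nat n)) = of_real a powr (- s) / of_real a ^ n"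
      using a by (simp add: powr_diff powr_nat')
    ultimately show "integral UNIV (f n) = Gamma s * of_real a powr (- s) * (pochhammer s n / fact n * (u / of_real a) ^ n)"
      using Gamma_integral_exp[OF sn a] by (simp add: f_def[abs_def] power_divide mult_ac)
    show "f n absolutely_integrable_on UNIV"
      unfolding f_def[abs_def] using Gamma_integral_exp_absolutely_integrable[OF sn a] by simp
  qed
  have f_eq: "f n x = exp (s * of_real x - of_real (a * exp x)) * ((u * of_real (exp x)) ^ n /\<^sub>R fact n)" for n x
  proof -
    have "exp ((s + of_nat n) * of_real x - of_real (a * exp x)) = exp (s * of_real x - of_real (a * exp x)) * exp (of_real x) ^ n"
      by (simp add: exp_add[symmetric] exp_of_nat_mult[symmetric] algebra_simps)
    then show ?thesis by (simp add: f_def power_mult_distrib scaleR_conv_of_real exp_of_real field_simps)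
  qed
  \<comment> \<open>The partial sums are dominated by the integrand with the positive rate \<open>a - \<bar>u\<bar>\<close>.\<close>
  have "(\<lambda>N. integral UNIV (\<lambda>x. \<Sum>n<N. f n x)) \<longlonglongrightarrow>
      integral UNIV (\<lambda>x. exp (s * of_real x - c * of_real (exp x)))"
  proof (rule dominated_convergence(2))
    show "(\<lambda>x. \<Sum>n<N. f n x) integrable_on UNIV" for N
      using fi by (intro integrable_sum) (auto intro: set_lebesgue_integral_eq_integral(1))
    show "(\<lambda>x. norm (exp (of_real (Re s) * of_real x - complex_of_real ((a - cmod u) * exp x)))) integrable_on UNIV"
      using Gamma_integral_exp_absolutely_integrable[of "of_real (Re s)" "a - cmod u"] assms ac
      by (simp add: absolutely_integrable_on_def u_def)
    fix x :: real
    have "(\<lambda>n. f n x) sums (exp (s * of_real x - of_real (a * exp x)) * exp (u * of_real (exp x)))"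
      unfolding f_eq by (intro sums_mult exp_converges)
    also have "exp (s * of_real x - of_real (a * exp x)) * exp (u * of_real (exp x)) = exp (s * of_real x - c * of_real (exp x))"
      by (simp add: u_def exp_add[symmetric] algebra_simps)
    finally show "(\<lambda>N. \<Sum>n<N. f n x) \<longlonglongrightarrow> exp (s * of_real x - c * of_real (exp x))"
      by (simp add: sums_def)
    fix N
    have "norm (\<Sum>n<N. f n x) \<le> (\<Sum>n<N. exp (Re s * x - a * exp x) * ((cmod u * exp x) ^ n /\<^sub>R fact n))"
      unfolding f_eq by (intro sum_norm_le) (simp add: norm_mult norm_power)
    also have "\<dots> \<le> exp (Re s * x - a * exp x) * exp (cmod u * exp x)"
      unfolding sum_distrib_left[symmetric]
    proof (rule mult_left_mono)
      have s: "(\<lambda>n. (cmod u * exp x) ^ n /\<^sub>R fact n) sums exp (cmod u * exp x)"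
        by (rule exp_converges)
      show "(\<Sum>n<N. (cmod u * exp x) ^ n /\<^sub>R fact n) \<le> exp (cmod u * exp x)"
        using sum_le_suminf[OF sums_summable[OF s], of "{..<N}"] sums_unique[OF s] by simp
    qed simp
    also have "\<dots> = norm (exp (of_real (Re s) * of_real x - complex_of_real ((a - cmod u) * exp x)))"
      by (simp add: exp_add[symmetric] algebra_simps)
    finally show "norm (\<Sum>n<N. f n x) \<le> norm (exp (of_real (Re s) * of_real x - complex_of_real ((a - cmod u) * exp x)))" .
  qed
  then have L: "(\<lambda>n. integral UNIV (f n)) sums integral UNIV (\<lambda>x. exp (s * of_real x - c * of_real (exp x)))"
    using fi by (simp add: sums_def integral_sum set_lebesgue_integral_eq_integral(1))
  have "cmod (u / of_real a) < 1" using ac a by (simp add: u_def norm_divide)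
  from binomial_series_neg[OF this, of s]
  have R: "(\<lambda>n. integral UNIV (f n)) sums (Gamma s * of_real a powr (- s) * (1 - u / of_real a) powr (- s))"
    unfolding If by (rule sums_mult)
  have "of_real a powr (- s) * (1 - u / of_real a) powr (- s) = c powr (- s)"
  proof -
    have "c = of_real a * (c / of_real a)" using a by simp
    also have "\<dots> powr (- s) = of_real a powr (- s) * (c / of_real a) powr (- s)"
      using a by (subst powr_times_real_left) auto
    finally show ?thesis using a by (simp add: u_def diff_divide_distrib)
  qed
  then show ?thesis using sums_unique2[OF L R] by (simp add: mult.assoc)
qed

section \<open>Hairpin integrals\<close>

text \<open>
  The contour \<open>\<gamma>(\<epsilon>, \<mu>)\<close> in the logarithmic coordinate \<open>w = ln \<zeta>\<close>, with \<open>a = ln \<epsilon>\<close> and \<open>t = \<mu>\<close>: in from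
  \<open>+\<infinity> - \<i> t\<close> along a horizontal ray, up the segment from \<open>a - \<i> t\<close> to \<open>a + \<i> t\<close>, and out to
  \<open>+\<infinity> + \<i> t\<close>. Powers of \<open>\<zeta>\<close> are entire functions of \<open>w\<close>, arcs become segments, and the substitution
  \<open>\<zeta> = u\<^sup>\<alpha>\<close> becomes multiplication by \<open>\<alpha>\<close>.
\<close>

definition hairpin :: "(complex \<Rightarrow> complex) \<Rightarrow> real \<Rightarrow> real \<Rightarrow> complex" where
  "hairpin h a t = integral {a..} (\<lambda>x. h (Complex x t)) - integral {a..} (\<lambda>x. h (Complex x (- t)))
     + \<i> * integral {- t..t} (\<lambda>y. h (Complex a y))"

definition hairpin_integrable :: "(complex \<Rightarrow> complex) \<Rightarrow> real \<Rightarrow> real \<Rightarrow> bool" where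
  "hairpin_integrable h a t \<longleftrightarrow>
     (\<lambda>x. h (Complex x t)) absolutely_integrable_on {a..} \<and>
     (\<lambda>x. h (Complex x (- t))) absolutely_integrable_on {a..} \<and>
     (\<lambda>y. h (Complex a y)) absolutely_integrable_on {- t..t}"

lemma continuous_on_Complex_left [continuous_intros]:
  "continuous_on S f \<Longrightarrow> continuous_on S (\<lambda>x. Complex (f x) c)"
  unfolding Complex_eq by (intro continuous_intros)

lemma continuous_on_Complex_right [continuous_intros]:
  "continuous_on S f \<Longrightarrow> continuous_on S (\<lambda>x. Complex c (f x))"
  unfolding Complex_eq by (intro continuous_intros)

lemma hairpin_cong:
  assumes "\<And>w. a \<le> Re w \<Longrightarrow> \<bar>Im w\<bar> \<le> t \<Longrightarrow> f w = g w" "0 \<le> t"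
  shows "hairpin f a t = hairpin g a t" "hairpin_integrable f a t \<longleftrightarrow> hairpin_integrable g a t"
proof -
  have "f (Complex x y) = g (Complex x y)" if "a \<le> x" "\<bar>y\<bar> \<le> t" for x y
    using assms(1)[of "Complex x y"] that by simp
  then have "integral S (\<lambda>x. f (Complex x y)) = integral S (\<lambda>x. g (Complex x y))"
    "(\<lambda>x. f (Complex x y)) absolutely_integrable_on S \<longleftrightarrow> (\<lambda>x. g (Complex x y)) absolutely_integrable_on S"
    "integral {- t..t} (\<lambda>x. f (Complex a x)) = integral {- t..t} (\<lambda>x. g (Complex a x))"
    "(\<lambda>x. f (Complex a x)) absolutely_integrable_on {- t..t} \<longleftrightarrow> (\<lambda>x. g (Complex a x)) absolutely_integrable_on {- t..t}"
    if "S = {a..}" "\<bar>y\<bar> \<le> t" for S y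
    using that by (intro Henstock_Kurzweil_Integration.integral_cong set_integrable_cong; force)+
  from this[OF refl, of t] this[OF refl, of "- t"]
  show "hairpin f a t = hairpin g a t" "hairpin_integrable f a t \<longleftrightarrow> hairpin_integrable g a t"
    using assms(2) by (simp_all add: hairpin_def hairpin_integrable_def)
qed

lemma hairpin_tendsto:
  assumes f: "\<And>n. hairpin_integrable (f n) a t" and k: "hairpin_integrable k a t"
    and lim: "\<And>w. a \<le> Re w \<Longrightarrow> (\<lambda>n. f n w) \<longlonglongrightarrow> g w"
    and bound: "\<And>n w. a \<le> Re w \<Longrightarrow> norm (f n w) \<le> C * norm (k w)"
  shows "hairpin_integrable g a t" "(\<lambda>n. hairpin (f n) a t) \<longlonglongrightarrow> hairpin g a t"
proof -
  have piece: "(\<lambda>x. g (u x)) absolutely_integrable_on S"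
    "(\<lambda>n. integral S (\<lambda>x. f n (u x))) \<longlonglongrightarrow> integral S (\<lambda>x. g (u x))"
    if "\<And>n. (\<lambda>x. f n (u x)) absolutely_integrable_on S" "(\<lambda>x. k (u x)) absolutely_integrable_on S"
      and "\<And>x. x \<in> S \<Longrightarrow> a \<le> Re (u x)" for u :: "real \<Rightarrow> complex" and S
    using integral_tendsto_dominated[OF that(1,2) lim[OF that(3)] bound[OF that(3)]] by auto
  have fs: "(\<lambda>x. f n (Complex x t)) absolutely_integrable_on {a..}"
    "(\<lambda>x. f n (Complex x (- t))) absolutely_integrable_on {a..}"
    "(\<lambda>y. f n (Complex a y)) absolutely_integrable_on {- t..t}" for n
    using f[of n] by (simp_all add: hairpin_integrable_def)
  have ks: "(\<lambda>x. k (Complex x t)) absolutely_integrable_on {a..}"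
    "(\<lambda>x. k (Complex x (- t))) absolutely_integrable_on {a..}"
    "(\<lambda>y. k (Complex a y)) absolutely_integrable_on {- t..t}"
    using k by (simp_all add: hairpin_integrable_def)
  note 1 = piece[OF fs(1) ks(1), simplified] and 2 = piece[OF fs(2) ks(2), simplified]
    and 3 = piece[OF fs(3) ks(3), simplified]
  show "hairpin_integrable g a t" using 1 2 3 by (simp add: hairpin_integrable_def)
  show "(\<lambda>n. hairpin (f n) a t) \<longlonglongrightarrow> hairpin g a t"
    unfolding hairpin_def using 1 2 3 by (intro tendsto_intros)
qed

lemma hairpin_cmult:
  assumes "hairpin_integrable h a t"
  shows "hairpin_integrable (\<lambda>w. c * h w) a t" "hairpin (\<lambda>w. c * h w) a t = c * hairpin h a t"
  using assms by (simp_all add: hairpin_integrable_def hairpin_def ring_distribs)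

lemma hairpin_add:
  assumes "hairpin_integrable f a t" "hairpin_integrable g a t"
  shows "hairpin_integrable (\<lambda>w. f w + g w) a t"
    "hairpin (\<lambda>w. f w + g w) a t = hairpin f a t + hairpin g a t"
proof -
  have d: "integral S (\<lambda>x. F x + G x) = integral S F + integral S G"
    if "F absolutely_integrable_on S" "G absolutely_integrable_on S" for F G :: "real \<Rightarrow> complex" and S
    using that by (intro Henstock_Kurzweil_Integration.integral_add set_lebesgue_integral_eq_integral(1))
  show "hairpin_integrable (\<lambda>w. f w + g w) a t"
    "hairpin (\<lambda>w. f w + g w) a t = hairpin f a t + hairpin g a t"
    using assms by (simp_all add: hairpin_integrable_def hairpin_def d ring_distribs)
qed

lemma hairpin_sums:
  assumes f: "\<And>n. hairpin_integrable (f n) a t" and k: "hairpin_integrable k a t"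
    and sums: "\<And>w. a \<le> Re w \<Longrightarrow> (\<lambda>n. f n w) sums g w"
    and bound: "\<And>n w. a \<le> Re w \<Longrightarrow> norm (f n w) \<le> c n * norm (k w)"
    and c: "summable c" "\<And>n. 0 \<le> c n"
  shows "hairpin_integrable g a t" "(\<lambda>n. hairpin (f n) a t) sums hairpin g a t"
proof -
  have F: "hairpin_integrable (\<lambda>w. \<Sum>n<N. f n w) a t \<and>
      hairpin (\<lambda>w. \<Sum>n<N. f n w) a t = (\<Sum>n<N. hairpin (f n) a t)" for N
  proof (induction N)
    case 0
    show ?case by (simp add: hairpin_integrable_def hairpin_def)
  next
    case (Suc N)
    then show ?case using hairpin_add[OF _ f[of N]] by simp
  qed
  have le: "norm (\<Sum>n<N. f n w) \<le> suminf c * norm (k w)" if "a \<le> Re w" for N w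
  proof -
    have "norm (\<Sum>n<N. f n w) \<le> (\<Sum>n<N. c n * norm (k w))"
      using bound[OF that] by (intro sum_norm_le) auto
    also have "\<dots> \<le> suminf c * norm (k w)"
      unfolding sum_distrib_right[symmetric] using c by (intro mult_right_mono sum_le_suminf) auto
    finally show ?thesis .
  qed
  have lim: "(\<lambda>N. \<Sum>n<N. f n w) \<longlonglongrightarrow> g w" if "a \<le> Re w" for w
    using sums[OF that] by (simp add: sums_def)
  note T = hairpin_tendsto[OF conjunct1[OF F] k lim le]
  show "hairpin_integrable g a t" by (rule T)
  show "(\<lambda>n. hairpin (f n) a t) sums hairpin g a t"
    using T(2) by (simp add: sums_def F)
qed

lemma hairpin_derivative:
  assumes P: "\<And>w. (P has_field_derivative h w) (at w)"
    and h: "hairpin_integrable h a t" and t: "0 \<le> t"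
    and lim: "((\<lambda>x. P (Complex x t)) \<longlongrightarrow> 0) at_top" "((\<lambda>x. P (Complex x (- t))) \<longlongrightarrow> 0) at_top"
  shows "hairpin h a t = 0"
proof -
  have ray: "((\<lambda>x. P (Complex x y)) has_vector_derivative h (Complex x y)) (at x)" for x y
  proof -
    have "((\<lambda>x. Complex x y) has_vector_derivative 1) (at x)"
      unfolding Complex_eq by (auto intro!: derivative_eq_intros)
    from field_vector_diff_chain_at[OF this P] show ?thesis by (simp add: o_def)
  qed
  have vert: "((\<lambda>y. P (Complex a y)) has_vector_derivative \<i> * h (Complex a y)) (at y)" for y
  proof -
    have "((\<lambda>y. Complex a y) has_vector_derivative \<i>) (at y)"
      unfolding Complex_eq by (auto intro!: derivative_eq_intros)
    from field_vector_diff_chain_at[OF this P] show ?thesis by (simp add: o_def)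
  qed
  have 1: "integral {a..} (\<lambda>x. h (Complex x y)) = - P (Complex a y)" if "y \<in> {t, - t}" for y
    using that h lim by (intro integral_from_to_infinity[OF _ ray]) (auto simp: hairpin_integrable_def)
  have "((\<lambda>y. \<i> * h (Complex a y)) has_integral P (Complex a t) - P (Complex a (- t))) {- t..t}"
    using t vert by (intro fundamental_theorem_of_calculus) (auto intro: has_vector_derivative_at_within)
  then have "\<i> * integral {- t..t} (\<lambda>y. h (Complex a y)) = P (Complex a t) - P (Complex a (- t))"
    by (simp add: integral_unique flip: integral_mult_right)
  then show ?thesis by (simp add: hairpin_def 1)
qed

lemma stretch_integral:
  fixes f :: "real \<Rightarrow> complex"
  assumes "c > 0" "f absolutely_integrable_on S" "S \<in> sets lebesgue"
  shows "(\<lambda>x. f (x / c)) absolutely_integrable_on (*) c ` S"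
    "integral ((*) c ` S) (\<lambda>x. f (x / c)) = of_real c * integral S f"
proof -
  have "(\<lambda>x. \<bar>c\<bar> *\<^sub>R f (c * x / c)) absolutely_integrable_on S \<and>
      integral S (\<lambda>x. \<bar>c\<bar> *\<^sub>R f (c * x / c)) = of_real c * integral S f"
    using assms by (simp add: scaleR_conv_of_real)
  then have "(\<lambda>x. f (x / c)) absolutely_integrable_on (*) c ` S \<and>
      integral ((*) c ` S) (\<lambda>x. f (x / c)) = of_real c * integral S f"
    using assms
    by (subst (asm) has_absolute_integral_change_of_variables_real[where g = "(*) c"])
       (auto intro!: derivative_eq_intros injI inj_onI)
  then show "(\<lambda>x. f (x / c)) absolutely_integrable_on (*) c ` S"
    "integral ((*) c ` S) (\<lambda>x. f (x / c)) = of_real c * integral S f" by auto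
qed

text \<open>
  In terms of \<open>\<zeta>\<close>, this is the substitution \<open>\<zeta> = u\<^sup>c\<close>.
\<close>

lemma hairpin_stretch:
  assumes h: "hairpin_integrable h a t" and c: "c > 0"
  shows "hairpin_integrable (\<lambda>w. h (w / of_real c)) (c * a) (c * t)"
    "hairpin (\<lambda>w. h (w / of_real c)) (c * a) (c * t) = of_real c * hairpin h a t"
proof -
  have eq: "Complex x (c * y) / of_real c = Complex (x / c) y"
    "Complex x (- (c * y)) / of_real c = Complex (x / c) (- y)"
    "Complex (c * x) y / of_real c = Complex x (y / c)" for x y
    using c by (simp_all add: complex_eq_iff)
  have im: "(*) c ` {a..} = {c * a..}" "(*) c ` {- t..t} = {- (c * t)..c * t}"
  proof -
    have "x \<in> (*) c ` {a..}" if "c * a \<le> x" for x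
      using that c by (intro image_eqI[of _ _ "x / c"]) (auto simp: field_simps)
    then show "(*) c ` {a..} = {c * a..}" using c by auto
    show "(*) c ` {- t..t} = {- (c * t)..c * t}" using c by (simp add: image_mult_atLeastAtMost_if) 
  qed
  note pieces = h[unfolded hairpin_integrable_def]
  note 1 = stretch_integral[OF c conjunct1[OF pieces], unfolded im, simplified]
  note 2 = stretch_integral[OF c conjunct1[OF conjunct2[OF pieces]], unfolded im, simplified]
  note 3 = stretch_integral[OF c conjunct2[OF conjunct2[OF pieces]], unfolded im, simplified]
  show "hairpin_integrable (\<lambda>w. h (w / of_real c)) (c * a) (c * t)"
    using 1 2 3 by (simp add: hairpin_integrable_def eq)
  show "hairpin (\<lambda>w. h (w / of_real c)) (c * a) (c * t) = of_real c * hairpin h a t"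
    using 1 2 3 by (simp add: hairpin_def eq ring_distribs)
qed

lemma contour_integral_horizontal:
  assumes "a < b"
  shows "contour_integral (linepath (Complex a y) (Complex b y)) h = integral {a..b} (\<lambda>x. h (Complex x y))"
proof -
  have "((\<lambda>z. h (z + \<i> * of_real y)) has_contour_integral I) (linepath (of_real a) (of_real b)) \<longleftrightarrow>
      (h has_contour_integral I) (linepath (Complex a y) (Complex b y))" for I
  proof -
    have "(\<lambda>x. linepath (of_real a) (of_real b) x + \<i> * of_real y) = linepath (Complex a y) (Complex b y)"
      by (auto simp: linepath_def complex_eq_iff fun_eq_iff algebra_simps)
    then show ?thesis using has_contour_integral_translate[of h I "\<i> * of_real y" "linepath (of_real a) (of_real b)"]
      by (simp add: o_def add.commute)
  qed
  moreover have "(\<lambda>x. h (complex_of_real x + \<i> * of_real y)) = (\<lambda>x. h (Complex x y))"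
    by (simp add: Complex_eq)
  ultimately have *: "(h has_contour_integral I) (linepath (Complex a y) (Complex b y)) \<longleftrightarrow>
      ((\<lambda>x. h (Complex x y)) has_integral I) {a..b}" for I
    using has_contour_integral_linepath_Reals_iff[of "of_real a" "of_real b" "\<lambda>z. h (z + \<i> * of_real y)" I] assms
    by simp
  show ?thesis
    unfolding contour_integral_def integral_def integrable_on_def contour_integrable_on_def * by simp
qed

text \<open>
  Moving the vertical side changes the integral by the integral around the rectangle between the old and
  the new position. The rays beyond \<open>b\<close> are common to both hairpins and cancel.
\<close>

lemma hairpin_shift:
  assumes h: "hairpin_integrable h b t" and ab: "a < b" and t: "0 < t"
    and cont: "continuous_on (path_image (rectpath (Complex a (- t)) (Complex b t))) h"
  shows "hairpin_integrable h a t"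
    "hairpin h b t - hairpin h a t = contour_integral (rectpath (Complex a (- t)) (Complex b t)) h"
proof -
  let ?R = "path_image (rectpath (Complex a (- t)) (Complex b t))"
  have R: "?R = {w. Re w \<in> {a, b} \<and> Im w \<in> {- t..t}} \<union> {w. Im w \<in> {- t, t} \<and> Re w \<in> {a..b}}"
    using ab t by (subst path_image_rectpath) auto
  have ch: "continuous_on {a..b} (\<lambda>x. h (Complex x y))" if "y \<in> {t, - t}" for y
    using that by (intro continuous_on_compose2[OF cont] continuous_intros) (auto simp: R)
  have cv: "continuous_on {- t..t} (\<lambda>y. h (Complex x y))" if "x \<in> {a, b}" for x
    using that by (intro continuous_on_compose2[OF cont] continuous_intros) (auto simp: R)
  have un: "{a..} = {a..b} \<union> {b..}" using ab by auto
  have abs: "(\<lambda>x. h (Complex x y)) absolutely_integrable_on {a..b}" if "y \<in> {t, - t}" for y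
    using absolutely_integrable_continuous_real[OF ch[OF that]] .
  have hb: "(\<lambda>x. h (Complex x y)) absolutely_integrable_on {b..}" if "y \<in> {t, - t}" for y
    using that h by (auto simp: hairpin_integrable_def)
  show ha: "hairpin_integrable h a t"
    unfolding hairpin_integrable_def un
    using abs hb absolutely_integrable_continuous_real[OF cv]
    by (auto intro!: absolutely_integrable_Un)
  have split: "integral {a..} (\<lambda>x. h (Complex x y)) = integral {a..b} (\<lambda>x. h (Complex x y)) + integral {b..} (\<lambda>x. h (Complex x y))"
    if "y \<in> {t, - t}" for y
    unfolding un
  proof (rule integral_Un)
    have "{a..b} \<inter> {b..} = {b}" using ab by auto
    then show "negligible ({a..b} \<inter> {b..})" by simp
  qed (use abs[OF that] hb[OF that] in \<open>auto intro: set_lebesgue_integral_eq_integral(1)\<close>)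
  let ?l = "\<lambda>z w. contour_integral (linepath z w) h"
  have int: "h contour_integrable_on linepath z w" if "closed_segment z w \<subseteq> ?R" for z w
    using that cont by (intro contour_integrable_continuous_linepath) (auto intro: continuous_on_subset)
  have seg: "closed_segment (Complex a (- t)) (Complex b (- t)) \<subseteq> ?R"
    "closed_segment (Complex b (- t)) (Complex b t) \<subseteq> ?R"
    "closed_segment (Complex b t) (Complex a t) \<subseteq> ?R"
    "closed_segment (Complex a t) (Complex a (- t)) \<subseteq> ?R"
    by (auto simp: rectpath_def Let_def path_image_join)
  have "contour_integral (rectpath (Complex a (- t)) (Complex b t)) h =
      ?l (Complex a (- t)) (Complex b (- t)) + (?l (Complex b (- t)) (Complex b t) +
      (?l (Complex b t) (Complex a t) + ?l (Complex a t) (Complex a (- t))))"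
    using seg[THEN int] by (simp add: rectpath_def Let_def contour_integral_join contour_integrable_join)
  also have "?l (Complex b t) (Complex a t) = - ?l (Complex a t) (Complex b t)"
    using seg[THEN int] contour_integral_reversepath[of "linepath (Complex a t) (Complex b t)" h]
    by (simp add: reversepath_linepath)
  also have "?l (Complex a t) (Complex a (- t)) = - ?l (Complex a (- t)) (Complex a t)"
    using contour_integral_reversepath[of "linepath (Complex a (- t)) (Complex a t)" h]
    by (simp add: reversepath_linepath)
  finally show "hairpin h b t - hairpin h a t = contour_integral (rectpath (Complex a (- t)) (Complex b t)) h"
    using t ab split[of t] split[of "- t"]
    by (simp add: hairpin_def contour_integral_horizontal contour_integral_linepath_same_Re ring_distribs)
qed

lemma hairpin_shift_holomorphic:
  assumes h: "hairpin_integrable h b t" and ab: "a < b" and t: "0 < t"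
    and holo: "h holomorphic_on {w. \<bar>Im w\<bar> < c}" and c: "t < c"
  shows "hairpin_integrable h a t" "hairpin h a t = hairpin h b t"
proof -
  let ?r = "rectpath (Complex a (- t)) (Complex b t)" and ?S = "{w :: complex. \<bar>Im w\<bar> < c}"
  have S: "?S = {w. Im w < c} \<inter> {w. - c < Im w}" by auto
  have sub: "path_image ?r \<subseteq> ?S"
    using ab t c by (subst path_image_rectpath) auto
  have "convex ?S" "open ?S" unfolding S
    by (intro convex_Int convex_halfspace_Im_lt convex_halfspace_Im_gt open_Int open_halfspace_Im_lt open_halfspace_Im_gt)+
  then have 0: "contour_integral ?r h = 0"
    using sub holo by (intro contour_integral_unique Cauchy_theorem_convex_simple[of _ ?S]) auto
  have cont: "continuous_on (path_image ?r) h"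
    using sub holo continuous_on_subset holomorphic_on_imp_continuous_on by blast
  show "hairpin_integrable h a t" "hairpin h a t = hairpin h b t"
    using hairpin_shift[OF h ab t cont] 0 by auto
qed

section \<open>Hankel's integral for the reciprocal Gamma function\<close>

lemma cos_neg_second_quadrant:
  assumes "pi / 2 < t" "t < pi"
  shows "cos t < 0"
proof -
  have "0 < cos (t - pi)" using assms by (intro cos_gt_zero_pi) linarith+
  then show ?thesis by (simp add: cos_diff)
qed

text \<open>
  On a ray bounded below, an exponential factor \<open>e\<^sup>s\<^sup>x\<close> may be increased at the cost of a constant; this
  moves \<open>s\<close> into the right half-plane, where the integral over the whole line is absolutely convergent.
\<close>

lemma ray_integrable:
  assumes "Re c > 0"
  shows "(\<lambda>x. exp (s * of_real x - c * of_real (exp x))) absolutely_integrable_on {a..}"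
proof (rule absolutely_integrable_continuous_bound)
  define r where "r = \<bar>Re s\<bar> + 1"
  have "(\<lambda>x. exp (of_real r * of_real x - c * of_real (exp x))) absolutely_integrable_on {a..}"
    by (rule set_integrable_subset[OF laplace_absolutely_integrable]) (use assms in \<open>auto simp: r_def\<close>)
  then show "(\<lambda>x. exp ((Re s - r) * a) * norm (exp (of_real r * of_real x - c * of_real (exp x)))) integrable_on {a..}"
    by (intro integrable_on_mult_right) (simp add: absolutely_integrable_on_def)
  fix x assume x: "x \<in> {a..}"
  have "(Re s - r) * x \<le> (Re s - r) * a"
    using x by (intro mult_left_mono_neg) (auto simp: r_def)
  then show "norm (exp (s * of_real x - c * of_real (exp x)))
      \<le> exp ((Re s - r) * a) * norm (exp (of_real r * of_real x - c * of_real (exp x)))"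
    by (simp add: exp_add[symmetric] algebra_simps)
qed (auto intro!: continuous_intros)

lemma ray_tendsto_0:
  assumes "Re c > 0"
  shows "((\<lambda>x. exp (s * of_real x - c * of_real (exp x))) \<longlongrightarrow> 0) at_top"
proof (rule tendsto_norm_zero_cancel)
  define \<sigma> \<kappa> where "\<sigma> = Re s" and "\<kappa> = Re c"
  have "\<kappa> > 0" using assms by (simp add: \<kappa>_def)
  then have "((\<lambda>x. exp (\<sigma> * x - \<kappa> * exp x)) \<longlongrightarrow> 0) at_top"
    by real_asymp
  then show "((\<lambda>x. norm (exp (s * of_real x - c * of_real (exp x)))) \<longlongrightarrow> 0) at_top"
    by (simp add: \<sigma>_def \<kappa>_def)
qed

text \<open>
  Hankel's integrand \<open>e\<^sup>u u\<^sup>-\<^sup>b du\<close> with \<open>u = e\<^sup>w\<close>, the factor \<open>e\<^sup>w\<close> of \<open>du\<close> included.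
\<close>

definition hankel :: "complex \<Rightarrow> complex \<Rightarrow> complex" where
  "hankel b w = exp (exp w + (1 - b) * w)"

text \<open>
  On a horizontal line, integrands of Hankel's type are constant multiples of Laplace integrands with rate
  \<open>- cis y\<close>, whose real part is positive for \<open>cos y < 0\<close>.
\<close>

lemma exp_linear_on_ray:
  "exp (exp (Complex x y) + s * Complex x y)
     = exp (\<i> * s * of_real y) * exp (s * of_real x - (- cis y) * of_real (exp x))"
proof -
  have "exp (Complex x y) = cis y * of_real (exp x)"
    by (simp add: exp_eq_polar mult.commute)
  then show ?thesis
    by (simp add: exp_add[symmetric] Complex_eq algebra_simps)
qed

lemma hankel_integrable:
  assumes "cos t < 0"
  shows "hairpin_integrable (hankel b) a t"
  unfolding hairpin_integrable_def
proof (intro conjI)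
  have "(\<lambda>x. hankel b (Complex x y)) absolutely_integrable_on {a..}" if "cos y < 0" for y
    unfolding hankel_def exp_linear_on_ray
    using ray_integrable[where c = "- cis y" and s = "1 - b" and a = a] that by (intro set_integrable_mult_right) auto
  then show "(\<lambda>x. hankel b (Complex x t)) absolutely_integrable_on {a..}"
    "(\<lambda>x. hankel b (Complex x (- t))) absolutely_integrable_on {a..}" using assms by auto
  show "(\<lambda>y. hankel b (Complex a y)) absolutely_integrable_on {- t..t}"
    unfolding hankel_def by (intro absolutely_integrable_continuous_real continuous_intros)
qed

lemma hairpin_hankel_indep:
  assumes "cos t < 0" "0 < t"
  shows "hairpin (hankel b) a t = hairpin (hankel b) a' t"
proof -
  have "hairpin (hankel b) a t = hairpin (hankel b) a' t" if "a < a'" for a a'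
    by (rule hairpin_shift_holomorphic[OF hankel_integrable that assms(2), where c = "t + 1"])
       (use assms in \<open>auto simp: hankel_def[abs_def] intro!: holomorphic_intros\<close>)
  then show ?thesis by (metis linorder_neqE_linordered_idom)
qed

text \<open>
  Integration by parts: \<open>e\<^sup>u u\<^sup>-\<^sup>b\<close> has derivative \<open>e\<^sup>u u\<^sup>-\<^sup>b - b e\<^sup>u u\<^sup>-\<^sup>b\<^sup>-\<^sup>1\<close> and vanishes at both ends of the
  contour. The reciprocal Gamma function satisfies the same recurrence.
\<close>

lemma hairpin_hankel_rec:
  assumes "cos t < 0" "0 < t"
  shows "hairpin (hankel b) a t = b * hairpin (hankel (b + 1)) a t"
proof -
  let ?P = "\<lambda>w. exp (exp w + (- b) * w)"
  note int = hankel_integrable[OF assms(1)]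
  have "hairpin (\<lambda>w. hankel b w + (- b) * hankel (b + 1) w) a t = 0"
  proof (rule hairpin_derivative)
    show "(?P has_field_derivative hankel b w + (- b) * hankel (b + 1) w) (at w)" for w
    proof -
      have "hankel b w = exp w * ?P w" by (simp add: hankel_def exp_add[symmetric] algebra_simps)
      moreover have "hankel (b + 1) w = ?P w" by (simp add: hankel_def)
      ultimately show ?thesis
        by (auto intro!: derivative_eq_intros simp: algebra_simps)
    qed
    show "hairpin_integrable (\<lambda>w. hankel b w + (- b) * hankel (b + 1) w) a t"
      by (intro hairpin_add hairpin_cmult int)
    have "((\<lambda>x. ?P (Complex x y)) \<longlongrightarrow> 0) at_top" if "cos y < 0" for y
      unfolding exp_linear_on_ray
      using ray_tendsto_0[of "- cis y" "- b"] that by (intro tendsto_mult_right_zero) auto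
    then show "((\<lambda>x. ?P (Complex x t)) \<longlongrightarrow> 0) at_top" "((\<lambda>x. ?P (Complex x (- t))) \<longlongrightarrow> 0) at_top"
      using assms by auto
  qed (use assms in simp)
  moreover have "hairpin (\<lambda>w. hankel b w + (- b) * hankel (b + 1) w) a t
      = hairpin (hankel b) a t + (- b) * hairpin (hankel (b + 1)) a t"
    by (simp only: hairpin_add(2)[OF int hairpin_cmult(1)[OF int]] hairpin_cmult(2)[OF int])
  ultimately show ?thesis by simp
qed

text \<open>
  For \<open>Re b < 1\<close> the integrand is integrable down to \<open>u = 0\<close>, so the vertical side can be pushed to
  \<open>- \<infinity>\<close>, where its contribution vanishes. What remains are two Laplace integrals over the whole line, with
  rates \<open>- cis (\<plusminus> t)\<close>; they equal \<open>\<Gamma>(1 - b) exp (\<plusminus> \<i> \<pi> (1 - b))\<close>. Their difference is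
  \<open>2 \<i> \<Gamma>(1 - b) sin (\<pi> b)\<close>, and the reflection formula applies.
\<close>

lemma hairpin_hankel_left_half_plane:
  assumes t: "pi / 2 < t" "t < pi" and b: "Re b < 1"
  shows "hairpin (hankel b) a t = 2 * of_real pi * \<i> * rGamma b"
proof -
  have ct: "cos t < 0" by (rule cos_neg_second_quadrant[OF t])
  have s: "Re (1 - b) > 0" using b by simp
  define R where "R y = exp (\<i> * (1 - b) * of_real y) * (Gamma (1 - b) * (- cis y) powr (- (1 - b)))" for y
  let ?ray = "\<lambda>y x. hankel b (Complex x y)"
  have abs: "?ray y absolutely_integrable_on UNIV" if "cos y < 0" for y
    unfolding hankel_def exp_linear_on_ray
    using laplace_absolutely_integrable[of "1 - b" "- cis y"] s that by (intro set_integrable_mult_right) auto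
  have R: "integral UNIV (?ray y) = R y" if "cos y < 0" for y
    unfolding hankel_def exp_linear_on_ray R_def
    using laplace_integral[of "1 - b" "- cis y"] s that by simp
  have lim: "(\<lambda>k. integral {- real k..} (?ray y)) \<longlonglongrightarrow> R y" if "cos y < 0" for y
    unfolding R[OF that, symmetric]
  proof (rule integral_tendsto_exhaustion[OF abs[OF that]])
    show "\<forall>\<^sub>F k in sequentially. x \<in> {- real k..}" for x
      using eventually_ge_at_top[of "nat \<lceil>- x\<rceil>"] by eventually_elim (use nat_ceiling_le_eq in auto)
  qed auto
  have arc: "(\<lambda>k. integral {- t..t} (\<lambda>y. hankel b (Complex (- real k) y))) \<longlonglongrightarrow> 0"
  proof (rule Lim_null_comparison)
    let ?B = "\<lambda>k. exp (1 + \<bar>Im b\<bar> * t) * exp (- (1 - Re b)) ^ k"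
    show "\<forall>\<^sub>F k in sequentially. norm (integral {- t..t} (\<lambda>y. hankel b (Complex (- real k) y))) \<le> ?B k * (t - - t)"
    proof (intro always_eventually allI integral_bound)
      fix k y assume y: "y \<in> {- t..t}"
      have "Re (exp (Complex (- real k) y)) \<le> norm (exp (Complex (- real k) y))" by (rule complex_Re_le_cmod)
      also have "\<dots> \<le> 1" by simp
      finally have 1: "Re (exp (Complex (- real k) y)) \<le> 1" .
      have "Im b * y \<le> \<bar>Im b\<bar> * \<bar>y\<bar>" by (metis abs_ge_self abs_mult)
      also have "\<dots> \<le> \<bar>Im b\<bar> * t" using y by (intro mult_left_mono) auto
      finally have "Re (exp (Complex (- real k) y) + (1 - b) * Complex (- real k) y)
          \<le> (1 + \<bar>Im b\<bar> * t) + real k * (- (1 - Re b))"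
        using 1 by (simp add: algebra_simps)
      then show "norm (hankel b (Complex (- real k) y)) \<le> ?B k"
        unfolding hankel_def norm_exp_eq_Re exp_of_nat_mult[symmetric] exp_add[symmetric] by simp
    qed (use t in \<open>auto simp: hankel_def intro!: continuous_intros\<close>)
    have "(\<lambda>k. exp (- (1 - Re b)) ^ k) \<longlonglongrightarrow> 0"
      using b by (intro LIMSEQ_power_zero) simp
    then show "(\<lambda>k. ?B k * (t - - t)) \<longlonglongrightarrow> 0"
      by (intro tendsto_mult_left_zero tendsto_mult_right_zero)
  qed
  have "(\<lambda>k. hairpin (hankel b) (- real k) t) \<longlonglongrightarrow> R t - R (- t) + \<i> * 0"
    unfolding hairpin_def using ct by (intro tendsto_intros lim arc) auto
  moreover have "hairpin (hankel b) (- real k) t = hairpin (hankel b) a t" for k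
    using t ct by (intro hairpin_hankel_indep) auto
  ultimately have H: "hairpin (hankel b) a t = R t - R (- t)"
    using LIMSEQ_unique[OF tendsto_const] by fastforce
  have ray: "R y = Gamma (1 - b) * exp (\<i> * ((1 - b) * of_real (y - u)))"
    if "- cis y = cis u" "u \<in> {- pi<..pi}" for y u
  proof -
    have "cis u powr (- (1 - b)) = exp (- (1 - b) * (of_real u * \<i>))"
      using that(2) by (simp add: powr_def Ln_cis)
    then show ?thesis unfolding R_def that(1) by (simp add: exp_add[symmetric] algebra_simps)
  qed
  have "- cis t = cis (t - pi)" "- cis (- t) = cis (pi - t)" by (simp_all add: complex_eq_iff cos_diff sin_diff)
  then have "R t = Gamma (1 - b) * exp (\<i> * ((1 - b) * of_real pi))"
    "R (- t) = Gamma (1 - b) * exp (- (\<i> * ((1 - b) * of_real pi)))"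
    using ray[of t "t - pi"] ray[of "- t" "pi - t"] t by auto
  then have "R t - R (- t) = Gamma (1 - b) *
      (exp (\<i> * ((1 - b) * of_real pi)) - exp (- (\<i> * ((1 - b) * of_real pi))))"
    by (simp only: right_diff_distrib)
  also have "\<dots> = Gamma (1 - b) * (2 * \<i> * sin ((1 - b) * of_real pi))"
    by (simp add: sin_exp_eq)
  also have "sin ((1 - b) * of_real pi) = of_real pi * (rGamma b * rGamma (1 - b))"
    by (subst rGamma_reflection_complex) (simp add: ring_distribs sin_diff mult.commute)
  also have "Gamma (1 - b) * (2 * \<i> * (of_real pi * (rGamma b * rGamma (1 - b))))
      = 2 * of_real pi * \<i> * rGamma b * (Gamma (1 - b) * rGamma (1 - b))"
    by (simp add: algebra_simps)
  also have "Gamma (1 - b) * rGamma (1 - b) = 1"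
  proof -
    have "1 - b \<notin> \<int>\<^sub>\<le>\<^sub>0" using s by (auto elim!: nonpos_Ints_cases simp: complex_eq_iff)
    then show ?thesis by (simp add: Gamma_def rGamma_eq_zero_iff)
  qed
  finally show ?thesis using H by simp
qed

text \<open>
  The recurrence expresses the integral for \<open>b + 1\<close> by the one for \<open>b\<close> unless \<open>b = 0\<close>; then both sides of it
  vanish. The missing value at \<open>1\<close> is obtained as a limit from the left.
\<close>

lemma hairpin_hankel_1:
  assumes t: "pi / 2 < t" "t < pi"
  shows "hairpin (hankel 1) 0 t = 2 * of_real pi * \<i> * rGamma 1"
proof -
  have ct: "cos t < 0" by (rule cos_neg_second_quadrant[OF t])
  define b where "b n = 1 - 1 / real (Suc n)" for n
  have b: "0 \<le> b n" "b n < 1" for n by (auto simp: b_def)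
  have "b \<longlonglongrightarrow> 1 - 0" unfolding b_def by (intro tendsto_intros LIMSEQ_Suc[OF lim_1_over_n])
  then have lim: "(\<lambda>n. complex_of_real (b n)) \<longlonglongrightarrow> 1" using tendsto_of_real by fastforce
  have "(\<lambda>n. hairpin (hankel (of_real (b n))) 0 t) \<longlonglongrightarrow> hairpin (hankel 1) 0 t"
  proof (rule hairpin_tendsto(2)[where k = "hankel 0" and C = 1])
    show "(\<lambda>n. hankel (of_real (b n)) w) \<longlonglongrightarrow> hankel 1 w" for w
      unfolding hankel_def by (intro tendsto_intros lim)
    show "norm (hankel (of_real (b n)) w) \<le> 1 * norm (hankel 0 w)" if "0 \<le> Re w" for n w
      using that b(1)[of n] by (simp add: hankel_def mult_left_le_one_le algebra_simps)
  qed (use ct in \<open>auto intro: hankel_integrable\<close>)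
  moreover have "(\<lambda>n. hairpin (hankel (of_real (b n))) 0 t) \<longlonglongrightarrow> 2 * of_real pi * \<i> * rGamma 1"
  proof -
    have "hairpin (hankel (of_real (b n))) 0 t = 2 * of_real pi * \<i> * rGamma (of_real (b n))" for n
      using b(2) t by (intro hairpin_hankel_left_half_plane) auto
    then show ?thesis by (simp only:) (intro tendsto_intros isCont_tendsto_compose[OF _ lim] isCont_rGamma continuous_ident)
  qed
  ultimately show ?thesis by (rule LIMSEQ_unique)
qed

text \<open>
  Hankel's formula. The recurrence extends it from \<open>Re b < 1\<close> one unit strip at a time.
\<close>

theorem hairpin_hankel:
  assumes t: "pi / 2 < t" "t < pi"
  shows "hairpin (hankel b) a t = 2 * of_real pi * \<i> * rGamma b"
proof -
  have ct: "cos t < 0" and t0: "0 < t"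
    using t cos_neg_second_quadrant[OF t] pi_gt_zero by linarith+
  have "hairpin (hankel b) 0 t = 2 * of_real pi * \<i> * rGamma b" if "Re b < real n + 1" for n
    using that
  proof (induction n arbitrary: b)
    case 0
    then show ?case using hairpin_hankel_left_half_plane[OF t] by simp
  next
    case (Suc n)
    show ?case
    proof (cases "b = 1")
      case True
      then show ?thesis using hairpin_hankel_1[OF t] by simp
    next
      case False
      have "(b - 1) * hairpin (hankel b) 0 t = hairpin (hankel (b - 1)) 0 t"
        using hairpin_hankel_rec[OF ct t0, of "b - 1"] by simp
      also have "\<dots> = 2 * of_real pi * \<i> * rGamma (b - 1)"
        using Suc.prems by (intro Suc.IH) simp
      also have "rGamma (b - 1) = (b - 1) * rGamma b"
        using rGamma_plus1[of "b - 1"] by simp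
      finally have "(b - 1) * hairpin (hankel b) 0 t = (b - 1) * (2 * of_real pi * \<i> * rGamma b)"
        by (simp add: algebra_simps)
      then show ?thesis using False by simp
    qed
  qed
  from this[of "nat \<lceil>Re b\<rceil>"] have "hairpin (hankel b) 0 t = 2 * of_real pi * \<i> * rGamma b"
    by linarith
  then show ?thesis using hairpin_hankel_indep[OF ct t0] by metis
qed

section \<open>The Prabhakar function as a hairpin integral\<close>

lemma hairpin_hankel_scaled:
  assumes \<alpha>: "0 < \<alpha>" and \<mu>: "pi * \<alpha> / 2 < \<mu>" "\<mu> < \<alpha> * pi"
  shows "hairpin_integrable (\<lambda>w. hankel b (w / of_real \<alpha>)) a \<mu>"
    "hairpin (\<lambda>w. hankel b (w / of_real \<alpha>)) a \<mu> = 2 * of_real pi * of_real \<alpha> * \<i> * rGamma b"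
proof -
  have t: "pi / 2 < \<mu> / \<alpha>" "\<mu> / \<alpha> < pi" using assms by (auto simp: field_simps)
  then have "cos (\<mu> / \<alpha>) < 0" by (rule cos_neg_second_quadrant)
  from hairpin_stretch[OF hankel_integrable[OF this] \<alpha>, of b "a / \<alpha>"]
  show "hairpin_integrable (\<lambda>w. hankel b (w / of_real \<alpha>)) a \<mu>"
    "hairpin (\<lambda>w. hankel b (w / of_real \<alpha>)) a \<mu> = 2 * of_real pi * of_real \<alpha> * \<i> * rGamma b"
    using \<alpha> hairpin_hankel[OF t, of b "a / \<alpha>"] by simp_all
qed

text \<open>
  The integrand of the representation, including the factor \<open>\<zeta>\<close> of \<open>d\<zeta> = \<zeta> dw\<close>, as a function of
  \<open>w = ln \<zeta>\<close> in the strip \<open>\<bar>Im w\<bar> < \<pi>\<close>.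
\<close>

definition prabhakar_kernel :: "real \<Rightarrow> complex \<Rightarrow> real \<Rightarrow> complex \<Rightarrow> complex \<Rightarrow> complex" where
  "prabhakar_kernel \<alpha> \<beta> \<delta> z w =
     hankel \<beta> (w / of_real \<alpha>) * (1 - z * exp (- w)) powr (- of_real \<delta>)"

text \<open>
  If \<open>\<bar>z\<bar> < \<epsilon>\<close>, then \<open>\<bar>z / \<zeta>\<bar>\<close> is at most \<open>\<bar>z\<bar> / \<epsilon> < 1\<close> on the contour, and \<open>(1 - z / \<zeta>)\<^sup>-\<^sup>\<delta>\<close> can be
  expanded in its binomial series. Each power \<open>\<zeta>\<^sup>-\<^sup>n\<close> shifts \<open>\<beta>\<close> to \<open>\<alpha> n + \<beta>\<close> in Hankel's integral, so
  termwise integration produces the Prabhakar series. In particular this shows that the series converges.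
\<close>

theorem prabhakar_hairpin:
  assumes \<alpha>: "0 < \<alpha>" and \<mu>: "pi * \<alpha> / 2 < \<mu>" "\<mu> < \<alpha> * pi"
    and \<delta>: "0 < \<delta>" and z: "cmod z < exp a"
  shows "hairpin_integrable (prabhakar_kernel \<alpha> \<beta> \<delta> z) a \<mu>"
    "hairpin (prabhakar_kernel \<alpha> \<beta> \<delta> z) a \<mu>
       = 2 * of_real pi * of_real \<alpha> * \<i> * prabhakar (of_real \<alpha>) \<beta> (of_real \<delta>) z"
proof -
  define p where "p n = (pochhammer (of_real \<delta>) n / fact n :: complex)" for n
  define q where "q = cmod z * exp (- a)"
  define f where "f n w = p n * z ^ n * hankel (of_real \<alpha> * of_nat n + \<beta>) (w / of_real \<alpha>)" for n w
  have q: "0 \<le> q" "q < 1" using z by (auto simp: q_def exp_minus field_simps)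
  have f_eq: "f n w = hankel \<beta> (w / of_real \<alpha>) * (p n * (z * exp (- w)) ^ n)" for n w
  proof -
    have "hankel (of_real \<alpha> * of_nat n + \<beta>) (w / of_real \<alpha>) = hankel \<beta> (w / of_real \<alpha>) * exp (- w) ^ n"
      unfolding hankel_def exp_of_nat_mult[symmetric] exp_add[symmetric] using \<alpha> by (simp add: field_simps)
    then show ?thesis by (simp add: f_def power_mult_distrib)
  qed
  have small: "cmod (z * exp (- w)) \<le> q" if "a \<le> Re w" for w
    unfolding q_def norm_mult using that by (intro mult_left_mono) auto
  note scaled = hairpin_hankel_scaled[OF \<alpha> \<mu>]
  have int: "hairpin_integrable (f n) a \<mu>"
    and hair: "hairpin (f n) a \<mu> = p n * z ^ n * (2 * of_real pi * of_real \<alpha> * \<i> * rGamma (of_real \<alpha> * of_nat n + \<beta>))" for n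
    unfolding f_def[abs_def]
    by (simp_all only: hairpin_cmult[OF scaled(1)] scaled(2))
  \<comment> \<open>The coefficients are nonnegative, so the binomial series at \<open>q\<close> is its own majorant.\<close>
  have norm_p: "p n * of_real q ^ n = of_real (norm (p n) * q ^ n)" for n
  proof -
    have "p n = of_real (pochhammer \<delta> n / fact n)" by (simp add: p_def pochhammer_of_real)
    moreover have "pochhammer \<delta> n / fact n \<ge> 0" using \<delta> by (simp add: pochhammer_nonneg)
    ultimately show ?thesis by (simp only: norm_of_real abs_of_nonneg of_real_mult of_real_power)
  qed
  have "summable (\<lambda>n. p n * of_real q ^ n)"
    using binomial_series_neg[of "of_real q" "of_real \<delta>"] q unfolding p_def by (intro sums_summable) auto
  then have sum: "summable (\<lambda>n. norm (p n) * q ^ n)"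
    unfolding norm_p by (simp only: summable_complex_of_real)
  have sums: "(\<lambda>n. f n w) sums prabhakar_kernel \<alpha> \<beta> \<delta> z w" if w: "a \<le> Re w" for w
    unfolding f_eq prabhakar_kernel_def p_def
    using small[OF w] q by (intro sums_mult binomial_series_neg) auto
  have le: "norm (f n w) \<le> norm (p n) * q ^ n * norm (hankel \<beta> (w / of_real \<alpha>))" if w: "a \<le> Re w" for n w
  proof -
    have "norm (f n w) = norm (p n) * cmod (z * exp (- w)) ^ n * norm (hankel \<beta> (w / of_real \<alpha>))"
      by (simp add: f_eq norm_mult norm_power mult_ac)
    also have "\<dots> \<le> norm (p n) * q ^ n * norm (hankel \<beta> (w / of_real \<alpha>))"
      by (intro mult_right_mono mult_left_mono power_mono small[OF w]) auto
    finally show ?thesis .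
  qed
  have nonneg: "0 \<le> norm (p n) * q ^ n" for n using q by simp
  note S = hairpin_sums[OF int scaled(1)[of \<beta>] sums le sum nonneg]
  show "hairpin_integrable (prabhakar_kernel \<alpha> \<beta> \<delta> z) a \<mu>" by (rule S)
  let ?c = "2 * of_real pi * of_real \<alpha> * \<i> :: complex"
  have "?c \<noteq> 0" using \<alpha> by simp
  have "(\<lambda>n. ?c * (p n * rGamma (of_real \<alpha> * of_nat n + \<beta>) * z ^ n)) sums hairpin (prabhakar_kernel \<alpha> \<beta> \<delta> z) a \<mu>"
    using S(2) unfolding hair by (simp add: mult_ac)
  then have "(\<lambda>n. p n * rGamma (of_real \<alpha> * of_nat n + \<beta>) * z ^ n) sums (hairpin (prabhakar_kernel \<alpha> \<beta> \<delta> z) a \<mu> / ?c)"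
    using sums_divide[of _ _ ?c] \<open>?c \<noteq> 0\<close> by fastforce
  then have "prabhakar (of_real \<alpha>) \<beta> (of_real \<delta>) z = hairpin (prabhakar_kernel \<alpha> \<beta> \<delta> z) a \<mu> / ?c"
    unfolding prabhakar_def p_def by (rule sums_unique[symmetric])
  then show "hairpin (prabhakar_kernel \<alpha> \<beta> \<delta> z) a \<mu> = ?c * prabhakar (of_real \<alpha>) \<beta> (of_real \<delta>) z"
    using \<open>?c \<noteq> 0\<close> by simp
qed

section \<open>From the contour to the hairpin\<close>

lemma Arg_exp: "\<bar>Im w\<bar> < pi \<Longrightarrow> Arg (exp w) = Im w"
  by (simp add: Arg_eq_Im_Ln abs_less_iff)

lemma prabhakar_integrand_exp:
  assumes "\<bar>Im w\<bar> < pi"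
  shows "prabhakar_integrand \<alpha> \<beta> \<delta> z (exp w) * exp w = prabhakar_kernel \<alpha> \<beta> \<delta> z w"
proof -
  have "exp w powr s = exp (s * w)" for s using assms by (simp add: powr_def abs_less_iff)
  then have "exp (exp w powr (1 / of_real \<alpha>)) * exp w powr ((1 - \<beta>) / of_real \<alpha> - 1) * exp w
      = hankel \<beta> (w / of_real \<alpha>)"
    by (simp add: hankel_def exp_add[symmetric] algebra_simps)
  moreover have "z / exp w = z * exp (- w)" by (simp add: exp_minus field_simps)
  ultimately show ?thesis by (simp add: prabhakar_integrand_def prabhakar_kernel_def mult_ac)
qed

text \<open>
  The substitution \<open>r = e\<^sup>x\<close> on a ray. Continuity provides the Borel measurability that separates
  integrability for the Lebesgue measure from integrability for its restriction to Borel sets.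
\<close>

lemma gamma_ray:
  fixes f :: "complex \<Rightarrow> complex"
  assumes \<epsilon>: "0 < \<epsilon>" and cont: "continuous_on {\<epsilon>..} (\<lambda>r. f (of_real r * cis y))"
    and int: "(\<lambda>x. f (exp (Complex x y)) * exp (Complex x y)) absolutely_integrable_on {ln \<epsilon>..}"
  shows "set_integrable lborel {\<epsilon>..} (\<lambda>r. f (of_real r * cis y))"
    "cis y * (LBINT r:{\<epsilon>..}. f (of_real r * cis y))
       = integral {ln \<epsilon>..} (\<lambda>x. f (exp (Complex x y)) * exp (Complex x y))"
proof -
  let ?F = "\<lambda>r. f (of_real r * cis y)"
  let ?G = "\<lambda>x. f (exp (Complex x y)) * exp (Complex x y)"
  have im: "exp ` {ln \<epsilon>..} = {\<epsilon>..}"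
  proof (intro equalityI subsetI)
    fix r assume "r \<in> {\<epsilon>..}"
    then show "r \<in> exp ` {ln \<epsilon>..}" using \<epsilon> by (intro image_eqI[of _ _ "ln r"]) auto
  next
    fix r assume "r \<in> exp ` {ln \<epsilon>..}"
    then obtain x where "r = exp x" "ln \<epsilon> \<le> x" by auto
    then show "r \<in> {\<epsilon>..}" using \<epsilon> exp_le_cancel_iff[of "ln \<epsilon>" x] by simp
  qed
  have eq: "\<bar>exp x\<bar> *\<^sub>R ?F (exp x) = cis (- y) * ?G x" for x
  proof -
    have "exp (Complex x y) = of_real (exp x) * cis y" by (simp add: exp_eq_polar)
    then have "cis (- y) * ?G x = (cis (- y) * cis y) * (of_real (exp x) * ?F (exp x))"
      by (simp only: mult_ac)
    then show ?thesis by (simp add: cis_mult scaleR_conv_of_real)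
  qed
  have "(\<lambda>x. \<bar>exp x\<bar> *\<^sub>R ?F (exp x)) absolutely_integrable_on {ln \<epsilon>..} \<and>
      integral {ln \<epsilon>..} (\<lambda>x. \<bar>exp x\<bar> *\<^sub>R ?F (exp x)) = cis (- y) * integral {ln \<epsilon>..} ?G"
    unfolding eq using int by simp
  moreover have "((\<lambda>x. \<bar>exp x\<bar> *\<^sub>R ?F (exp x)) absolutely_integrable_on {ln \<epsilon>..} \<and>
      integral {ln \<epsilon>..} (\<lambda>x. \<bar>exp x\<bar> *\<^sub>R ?F (exp x)) = I) \<longleftrightarrow>
      (?F absolutely_integrable_on exp ` {ln \<epsilon>..} \<and> integral (exp ` {ln \<epsilon>..}) ?F = I)" for I
    by (rule has_absolute_integral_change_of_variables_real)
       (auto intro: DERIV_subset[OF DERIV_exp] inj_onI)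
  ultimately have A: "?F absolutely_integrable_on {\<epsilon>..}" "integral {\<epsilon>..} ?F = cis (- y) * integral {ln \<epsilon>..} ?G"
    unfolding im by blast+
  have "(\<lambda>r. indicator {\<epsilon>..} r *\<^sub>R ?F r) \<in> borel_measurable lborel"
    using borel_measurable_continuous_on_indicator[OF _ cont] by simp
  then show int: "set_integrable lborel {\<epsilon>..} ?F"
    using A(1) unfolding set_integrable_def by (simp add: integrable_completion)
  have "cis y * (LBINT r:{\<epsilon>..}. ?F r) = (cis y * cis (- y)) * integral {ln \<epsilon>..} ?G"
    using set_borel_integral_eq_integral(2)[OF int] A(2) by simp
  then show "cis y * (LBINT r:{\<epsilon>..}. ?F r) = integral {ln \<epsilon>..} ?G" by (simp add: cis_mult)
qed

lemma gamma_integral_hairpin: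
  assumes \<epsilon>: "0 < \<epsilon>" and \<mu>: "0 < \<mu>" "\<mu> < pi"
    and cont: "continuous_on (gamma_contour \<epsilon> \<mu>) f"
    and int: "hairpin_integrable (\<lambda>w. f (exp w) * exp w) (ln \<epsilon>) \<mu>"
  shows "gamma_integrable \<epsilon> \<mu> f" "gamma_integral \<epsilon> \<mu> f = hairpin (\<lambda>w. f (exp w) * exp w) (ln \<epsilon>) \<mu>"
proof -
  note pieces = gamma_contour_eq_pieces[OF \<epsilon> \<mu>]
  have c: "continuous_on {\<epsilon>..} (\<lambda>r. f (of_real r * cis y))" if "y \<in> {\<mu>, - \<mu>}" for y
    using that by (intro continuous_on_compose2[OF cont] continuous_intros) (auto simp: pieces)
  have i: "(\<lambda>x. f (exp (Complex x y)) * exp (Complex x y)) absolutely_integrable_on {ln \<epsilon>..}" if "y \<in> {\<mu>, - \<mu>}" for y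
    using int that by (auto simp: hairpin_integrable_def)
  note ray = gamma_ray[OF \<epsilon> c i]
  have "f contour_integrable_on part_circlepath 0 \<epsilon> (- \<mu>) \<mu>"
    by (intro contour_integrable_continuous_part_circlepath continuous_on_subset[OF cont]) (auto simp: pieces)
  then show "gamma_integrable \<epsilon> \<mu> f"
    using ray(1)[of \<mu>] ray(1)[of "- \<mu>"] by (simp add: gamma_integrable_def)
  have "exp (Complex (ln \<epsilon>) y) = of_real \<epsilon> * cis y" for y using \<epsilon> by (simp add: exp_eq_polar)
  then have "contour_integral (part_circlepath 0 \<epsilon> (- \<mu>) \<mu>) f
      = integral {- \<mu>..\<mu>} (\<lambda>y. \<i> * (f (exp (Complex (ln \<epsilon>) y)) * exp (Complex (ln \<epsilon>) y)))"
    using \<mu> by (simp add: contour_integral_part_circlepath_eq mult_ac)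
  then show "gamma_integral \<epsilon> \<mu> f = hairpin (\<lambda>w. f (exp w) * exp w) (ln \<epsilon>) \<mu>"
    using ray(2)[of \<mu>] ray(2)[of "- \<mu>"] by (simp add: gamma_integral_def hairpin_def)
qed

lemma not_nonpos_Reals_Arg: "\<zeta> \<noteq> 0 \<Longrightarrow> Arg \<zeta> \<noteq> pi \<Longrightarrow> \<zeta> \<notin> \<real>\<^sub>\<le>\<^sub>0"
  by (auto simp: complex_nonpos_Reals_iff Arg_eq_pi complex_eq_iff)

lemma deriv_exp_complex: "deriv exp w = exp (w :: complex)"
  by (intro DERIV_imp_deriv DERIV_exp)

section \<open>The residue picked up when the contour crosses a pole\<close>

text \<open>
  The exponential function maps the rectangle to the boundary of an annular sector. On the strip
  \<open>\<bar>Im w\<bar> < \<pi>\<close> it takes the value \<open>z\<close> only at \<open>Ln z\<close>, so \<open>e\<^sup>w / (e\<^sup>w - z)\<close> has a single simple pole inside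
  the rectangle, with residue 1.
\<close>

lemma winding_number_exp_rectpath:
  assumes t: "0 < t" "t < pi" and z: "exp a < cmod z" "cmod z < exp b" "\<bar>Arg z\<bar> < t"
  defines "r \<equiv> rectpath (Complex a (- t)) (Complex b t)"
  shows "z \<notin> path_image (exp \<circ> r)" "winding_number (exp \<circ> r) z = 1"
proof -
  let ?S = "{w :: complex. \<bar>Im w\<bar> < pi}" and ?p = "Ln z"
  have z0: "z \<noteq> 0" using z by (metis exp_gt_zero less_trans norm_zero order_less_irrefl)
  have p: "a < Re ?p" "Re ?p < b" "- t < Im ?p" "Im ?p < t" "exp ?p = z"
    using z z0 by (auto simp: Arg_eq_Im_Ln Re_Ln exp_less_cancel_iff[of a, symmetric]
        exp_less_cancel_iff[of _ b, symmetric] simp del: exp_less_cancel_iff)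
  have ab: "a < b" using p by simp
  have im: "path_image r = {w. Re w \<in> {a, b} \<and> Im w \<in> {- t..t}} \<union> {w. Im w \<in> {- t, t} \<and> Re w \<in> {a..b}}"
    unfolding r_def using ab t by (subst path_image_rectpath) auto
  have r: "path_image r \<subseteq> ?S" "?p \<notin> path_image r" using t p by (auto simp: im)
  have exp_eq: "w = ?p" if "w \<in> ?S" "exp w = z" for w
    using that by (simp flip: that(2) add: abs_less_iff)
  have valid: "valid_path r" "pathfinish r = pathstart r" by (simp_all add: r_def)
  show nz: "z \<notin> path_image (exp \<circ> r)"
    using exp_eq r by (auto simp: path_image_compose)
  have S: "?S = {w. Im w < pi} \<inter> {w. - pi < Im w}" by auto
  have cS: "convex ?S" "open ?S" unfolding S
    by (intro convex_Int convex_halfspace_Im_lt convex_halfspace_Im_gt open_Int open_halfspace_Im_lt open_halfspace_Im_gt)+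
  have valid_exp: "valid_path (exp \<circ> r)"
    by (intro valid_path_compose_holomorphic[OF valid(1), of _ UNIV]) (auto intro!: holomorphic_intros)
  let ?f = "\<lambda>w. exp w / (exp w - z)"
  have "winding_number (exp \<circ> r) z = 1 / (2 * pi * \<i>) * contour_integral (exp \<circ> r) (\<lambda>w. 1 / (w - z))"
    by (rule winding_number_valid_path[OF valid_exp nz])
  also have "contour_integral (exp \<circ> r) (\<lambda>w. 1 / (w - z)) = contour_integral r ?f"
    by (subst contour_integral_comp_analyticW[where s = UNIV]) (auto intro!: analytic_intros valid simp: deriv_exp_complex)
  also have "\<dots> = 2 * pi * \<i> * (\<Sum>p\<in>{?p}. winding_number r p * residue ?f p)"
  proof (rule Residue_theorem[of ?S])
    show "?f holomorphic_on ?S - {?p}" using exp_eq by (intro holomorphic_intros) auto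
    show "path_image r \<subseteq> ?S - {?p}" using r by auto
    show "\<forall>w. w \<notin> ?S \<longrightarrow> winding_number r w = 0"
      using winding_number_zero_outside[OF valid_path_imp_path[OF valid(1)] cS(1) valid(2)] r(1) by blast
  qed (use cS valid convex_connected in auto)
  finally have W: "winding_number (exp \<circ> r) z = winding_number r ?p * residue ?f ?p" by (simp add: o_def)
  have "residue ?f ?p = exp ?p / exp ?p"
    by (rule residue_simple_pole_deriv[where s = UNIV])
       (auto intro!: holomorphic_intros derivative_eq_intros simp: p z0)
  moreover have "winding_number r ?p = 1"
    unfolding r_def using p by (intro winding_number_rectpath) (auto simp: in_box_complex_iff)
  ultimately show "winding_number (exp \<circ> r) z = 1" using W by simp
qed

text \<open>
  The residue at the pole of higher order is taken in the coordinate \<open>\<zeta>\<close>, where it is a Taylor coefficient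
  of \<open>g\<close>. The residue theorem is applied in the slit plane, which is simply connected.
\<close>

lemma contour_integral_exp_rectpath_pole:
  assumes t: "0 < t" "t < pi" and z: "exp a < cmod z" "cmod z < exp b" "\<bar>Arg z\<bar> < t"
    and g: "g holomorphic_on - \<real>\<^sub>\<le>\<^sub>0"
  shows "contour_integral (rectpath (Complex a (- t)) (Complex b t)) (\<lambda>w. g (exp w) / (exp w - z) ^ Suc m * exp w)
     = 2 * of_real pi * \<i> * ((deriv ^^ m) g z / fact m)"
proof -
  define r where "r = rectpath (Complex a (- t)) (Complex b t)"
  let ?S = "- \<real>\<^sub>\<le>\<^sub>0 :: complex set" and ?f = "\<lambda>\<zeta>. g \<zeta> / (\<zeta> - z) ^ Suc m"
  have "exp a < exp b" using z(1,2) by (rule less_trans)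
  then have ab: "a < b" by simp
  have im: "path_image r \<subseteq> {w. \<bar>Im w\<bar> \<le> t}"
    unfolding r_def using ab t by (subst path_image_rectpath) auto
  have S: "?S = - (complex_of_real ` {..0})" by (auto simp: nonpos_Reals_def)
  have sc: "simply_connected ?S" unfolding S by (rule simply_connected_slotted_complex_plane_left)
  have valid: "valid_path r" "pathfinish r = pathstart r" by (simp_all add: r_def)
  have valid_exp: "valid_path (exp \<circ> r)"
    by (intro valid_path_compose_holomorphic[OF valid(1), of _ UNIV]) (auto intro!: holomorphic_intros)
  have loop: "pathfinish (exp \<circ> r) = pathstart (exp \<circ> r)"
    using valid(2) by (simp add: pathfinish_compose pathstart_compose)
  have sub: "path_image (exp \<circ> r) \<subseteq> ?S"
  proof
    fix \<zeta> assume "\<zeta> \<in> path_image (exp \<circ> r)"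
    then obtain w where w: "\<zeta> = exp w" "\<bar>Im w\<bar> \<le> t" using im by (auto simp: path_image_compose)
    then have "Arg \<zeta> \<noteq> pi" "\<zeta> \<noteq> 0" using t Arg_exp[of w] by auto
    then show "\<zeta> \<in> ?S" using not_nonpos_Reals_Arg by blast
  qed
  have zS: "z \<in> ?S"
  proof -
    have "z \<noteq> 0" using z by (metis exp_gt_zero less_trans norm_zero order_less_irrefl)
    moreover have "Arg z \<noteq> pi" using z t by auto
    ultimately show ?thesis using not_nonpos_Reals_Arg by blast
  qed
  note wind = winding_number_exp_rectpath[OF t z, folded r_def]
  have "contour_integral r (\<lambda>w. g (exp w) / (exp w - z) ^ Suc m * exp w) = contour_integral (exp \<circ> r) ?f"
    by (subst contour_integral_comp_analyticW[where s = UNIV]) (auto intro!: analytic_intros valid simp: mult_ac deriv_exp_complex)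
  also have "\<dots> = 2 * pi * \<i> * (\<Sum>p\<in>{z}. winding_number (exp \<circ> r) p * residue ?f p)"
  proof (rule Residue_theorem[of ?S])
    show "?f holomorphic_on ?S - {z}"
      by (intro holomorphic_intros holomorphic_on_subset[OF g]) auto
    show "\<forall>w. w \<notin> ?S \<longrightarrow> winding_number (exp \<circ> r) w = 0"
      using simply_connected_imp_winding_number_zero[OF sc valid_path_imp_path[OF valid_exp] sub loop] by blast
  qed (use sub wind loop valid_exp simply_connected_imp_connected[OF sc] in auto)
  also have "\<dots> = 2 * of_real pi * \<i> * ((deriv ^^ m) g z / fact m)"
    using wind(2) residue_holomorphic_over_power[OF _ zS g] by (simp add: open_Compl)
  finally show ?thesis by (simp add: r_def)
qed

section \<open>The contour integral representation\<close>

lemma gamma_contour_slit: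
  assumes "0 < \<epsilon>" "\<mu> < pi" "\<zeta> \<in> gamma_contour \<epsilon> \<mu>"
  shows "\<zeta> \<noteq> 0" "\<zeta> \<notin> \<real>\<^sub>\<le>\<^sub>0"
proof -
  show 0: "\<zeta> \<noteq> 0" using assms by (auto simp: gamma_contour_def)
  have "Arg \<zeta> \<noteq> pi" using assms by (auto simp: gamma_contour_def)
  then show "\<zeta> \<notin> \<real>\<^sub>\<le>\<^sub>0" using 0 not_nonpos_Reals_Arg by blast
qed

text \<open>
  The value \<open>1 - z / \<zeta>\<close> meets the branch cut only if \<open>z\<close> lies on the ray through \<open>\<zeta>\<close>, at \<open>\<zeta>\<close> or beyond it.
\<close>

lemma one_minus_divide_slit:
  fixes z \<zeta> :: complex
  assumes "\<zeta> \<noteq> 0" "cmod z < cmod \<zeta> \<or> Arg z \<noteq> Arg \<zeta>"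
  shows "1 - z / \<zeta> \<notin> \<real>\<^sub>\<le>\<^sub>0"
proof
  assume "1 - z / \<zeta> \<in> \<real>\<^sub>\<le>\<^sub>0"
  then obtain s where s: "1 - z / \<zeta> = of_real s" "s \<le> 0" by (auto elim: nonpos_Reals_cases)
  then have "z / \<zeta> = of_real (1 - s)" by (simp add: algebra_simps)
  then have z: "z = of_real (1 - s) * \<zeta>" using assms by (simp add: field_simps)
  then have "Arg z = Arg \<zeta>" using s by (simp only: Arg_times_of_real)
  moreover have "cmod z = (1 - s) * cmod \<zeta>" using s by (simp only: z norm_mult norm_of_real)
  moreover have "1 * cmod \<zeta> \<le> (1 - s) * cmod \<zeta>" using s by (intro mult_right_mono) auto
  ultimately show False using assms by simp
qed

lemma continuous_on_prabhakar_integrand: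
  assumes "\<And>\<zeta>. \<zeta> \<in> S \<Longrightarrow> \<zeta> \<notin> \<real>\<^sub>\<le>\<^sub>0" "\<And>\<zeta>. \<zeta> \<in> S \<Longrightarrow> 1 - z / \<zeta> \<notin> \<real>\<^sub>\<le>\<^sub>0"
  shows "continuous_on S (prabhakar_integrand \<alpha> \<beta> \<delta> z)"
proof -
  have "\<zeta> \<noteq> 0" if "\<zeta> \<in> S" for \<zeta> using assms(1)[OF that] by auto
  then have "prabhakar_integrand \<alpha> \<beta> \<delta> z holomorphic_on S"
    unfolding prabhakar_integrand_def[abs_def] using assms by (intro holomorphic_intros)
  then show ?thesis by (rule holomorphic_on_imp_continuous_on)
qed

lemma prabhakar_g_holomorphic: "prabhakar_g \<alpha> \<beta> \<delta> holomorphic_on - \<real>\<^sub>\<le>\<^sub>0"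
  unfolding prabhakar_g_def[abs_def] by (intro holomorphic_intros) auto

text \<open>
  The common last step for both regions: \<open>D\<close> is the residue picked up by the contour, which is 0 for
  \<open>z\<close> to its left.
\<close>

lemma prabhakar_of_hairpin_value:
  assumes \<alpha>: "0 < \<alpha>" and \<mu>: "0 < \<mu>" "\<mu> < pi" and \<epsilon>: "0 < \<epsilon>"
    and cont: "continuous_on (gamma_contour \<epsilon> \<mu>) (prabhakar_integrand \<alpha> \<beta> \<delta> z)"
    and int: "hairpin_integrable (prabhakar_kernel \<alpha> \<beta> \<delta> z) (ln \<epsilon>) \<mu>"
    and val: "2 * of_real pi * of_real \<alpha> * \<i> * P
                = hairpin (prabhakar_kernel \<alpha> \<beta> \<delta> z) (ln \<epsilon>) \<mu> + 2 * of_real pi * \<i> * D"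
  shows "gamma_integrable \<epsilon> \<mu> (prabhakar_integrand \<alpha> \<beta> \<delta> z)"
    "P = 1 / (2 * of_real pi * of_real \<alpha> * \<i>) * gamma_integral \<epsilon> \<mu> (prabhakar_integrand \<alpha> \<beta> \<delta> z)
           + 1 / of_real \<alpha> * D"
proof -
  let ?f = "prabhakar_integrand \<alpha> \<beta> \<delta> z"
  have eq: "?f (exp w) * exp w = prabhakar_kernel \<alpha> \<beta> \<delta> z w" if "ln \<epsilon> \<le> Re w" "\<bar>Im w\<bar> \<le> \<mu>" for w
    using that \<mu> by (intro prabhakar_integrand_exp) auto
  note cong = hairpin_cong[of "ln \<epsilon>" \<mu>, OF eq less_imp_le[OF \<mu>(1)]]
  have "hairpin_integrable (\<lambda>w. ?f (exp w) * exp w) (ln \<epsilon>) \<mu>" using int by (simp only: cong)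
  note G = gamma_integral_hairpin[OF \<epsilon> \<mu> cont this]
  show "gamma_integrable \<epsilon> \<mu> ?f" by (rule G)
  have "gamma_integral \<epsilon> \<mu> ?f = hairpin (prabhakar_kernel \<alpha> \<beta> \<delta> z) (ln \<epsilon>) \<mu>"
    unfolding G(2) by (rule cong)
  then show "P = 1 / (2 * of_real pi * of_real \<alpha> * \<i>) * gamma_integral \<epsilon> \<mu> ?f + 1 / of_real \<alpha> * D"
    using val \<alpha> by (simp add: field_simps)
qed

text \<open>
  A point \<open>z\<close> of this region with \<open>\<bar>z\<bar> \<ge> \<epsilon>\<close> has \<open>\<bar>Arg z\<bar> > \<mu>\<close>. The integrand is then holomorphic in the
  whole sector \<open>\<bar>Arg \<zeta>\<bar> < \<bar>Arg z\<bar>\<close>, so the arc may be moved out beyond \<open>z\<close>, where the series expansion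
  applies.
\<close>

lemma prabhakar_G_minus:
  assumes \<delta>: "0 < \<delta>" and \<alpha>: "0 < \<alpha>" and \<epsilon>: "0 < \<epsilon>"
    and \<mu>: "pi * \<alpha> / 2 < \<mu>" "\<mu> < \<alpha> * pi" "\<mu> < pi" and z: "z \<in> G_minus \<epsilon> \<mu>"
  shows "gamma_integrable \<epsilon> \<mu> (prabhakar_integrand \<alpha> \<beta> \<delta> z) \<and>
    prabhakar (of_real \<alpha>) \<beta> (of_real \<delta>) z =
      1 / (2 * of_real pi * of_real \<alpha> * \<i>) * gamma_integral \<epsilon> \<mu> (prabhakar_integrand \<alpha> \<beta> \<delta> z)"
proof -
  let ?k = "prabhakar_kernel \<alpha> \<beta> \<delta> z"
  let ?E = "prabhakar (of_real \<alpha>) \<beta> (of_real \<delta>) z"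
  have "0 < pi * \<alpha> / 2" using \<alpha> by simp
  then have \<mu>0: "0 < \<mu>" using \<mu>(1) by linarith
  have cont: "continuous_on (gamma_contour \<epsilon> \<mu>) (prabhakar_integrand \<alpha> \<beta> \<delta> z)"
    using z gamma_contour_slit[OF \<epsilon> \<mu>(3)]
    by (intro continuous_on_prabhakar_integrand one_minus_divide_slit)
       (auto simp: G_minus_eq gamma_contour_def)
  have K: "hairpin_integrable ?k (ln \<epsilon>) \<mu> \<and> hairpin ?k (ln \<epsilon>) \<mu> = 2 * of_real pi * of_real \<alpha> * \<i> * ?E"
  proof (cases "cmod z < \<epsilon>")
    case True
    then show ?thesis using prabhakar_hairpin[OF \<alpha> \<mu>(1,2) \<delta>, of z "ln \<epsilon>"] \<epsilon> by simp
  next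
    case False
    \<comment> \<open>Any arc of radius larger than \<open>\<bar>z\<bar>\<close> would serve; this one has radius \<open>\<bar>z\<bar> + 1\<close>.\<close>
    define b where "b = ln (cmod z + 1)"
    have "0 < cmod z + 1" by (simp add: add_nonneg_pos)
    then have b: "exp b = cmod z + 1" by (simp add: b_def)
    have ab: "ln \<epsilon> < b" unfolding b_def using False \<epsilon> by simp
    have c: "\<mu> < \<bar>Arg z\<bar>" using z False by (auto simp: G_minus_eq)
    have holo: "?k holomorphic_on {w. \<bar>Im w\<bar> < \<bar>Arg z\<bar>}"
    proof -
      have "1 - z * exp (- w) \<notin> \<real>\<^sub>\<le>\<^sub>0" if "\<bar>Im w\<bar> < \<bar>Arg z\<bar>" for w
      proof -
        have "\<bar>Im w\<bar> < pi" using that Arg_bounded[of z] by linarith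
        then have "Arg z \<noteq> Arg (exp w)" using that Arg_exp[of w] by auto
        then show ?thesis using one_minus_divide_slit[of "exp w" z] by (simp add: exp_minus field_simps)
      qed
      then show ?thesis unfolding prabhakar_kernel_def[abs_def] hankel_def
        using \<alpha> by (intro holomorphic_intros) auto
    qed
    have "cmod z < exp b" using b by simp
    note B = prabhakar_hairpin[OF \<alpha> \<mu>(1,2) \<delta> this, of \<beta>]
    show ?thesis using hairpin_shift_holomorphic[OF B(1) ab \<mu>0 holo c] B(2) by simp
  qed
  then show ?thesis
    using prabhakar_of_hairpin_value[OF \<alpha> \<mu>0 \<mu>(3) \<epsilon> cont, of ?E 0] by simp
qed

text \<open>
  For integer \<open>\<delta>\<close> the integrand is single-valued near \<open>z\<close>, and moving the arc out beyond \<open>z\<close> crosses a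
  pole of order \<open>\<delta>\<close>. The series expansion applies on the outer contour; the difference of the two contours
  is the residue, namely a derivative of \<open>prabhakar_g\<close>.
\<close>

lemma prabhakar_G_plus:
  assumes \<delta>: "0 < \<delta>" "\<delta> = of_nat n" and \<alpha>: "0 < \<alpha>" and \<epsilon>: "0 < \<epsilon>"
    and \<mu>: "pi * \<alpha> / 2 < \<mu>" "\<mu> < \<alpha> * pi" "\<mu> < pi" and z: "z \<in> G_plus \<epsilon> \<mu>"
  shows "gamma_integrable \<epsilon> \<mu> (prabhakar_integrand \<alpha> \<beta> \<delta> z) \<and>
    prabhakar (of_real \<alpha>) \<beta> (of_real \<delta>) z =
      1 / (2 * of_real pi * of_real \<alpha> * \<i>) * gamma_integral \<epsilon> \<mu> (prabhakar_integrand \<alpha> \<beta> \<delta> z)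
      + 1 / (of_real \<alpha> * Gamma (of_real \<delta>)) * (deriv ^^ (n - 1)) (prabhakar_g \<alpha> \<beta> \<delta>) z"
proof -
  let ?k = "prabhakar_kernel \<alpha> \<beta> \<delta> z" and ?f = "prabhakar_integrand \<alpha> \<beta> \<delta> z"
  let ?g = "prabhakar_g \<alpha> \<beta> \<delta>"
  let ?E = "prabhakar (of_real \<alpha>) \<beta> (of_real \<delta>) z"
  obtain m where m: "n = Suc m" using \<delta> by (cases n) auto
  let ?h = "\<lambda>w. ?g (exp w) / (exp w - z) ^ Suc m * exp w"
  let ?D = "(deriv ^^ m) ?g z / fact m"
  have "0 < pi * \<alpha> / 2" using \<alpha> by simp
  then have \<mu>0: "0 < \<mu>" using \<mu>(1) by linarith
  have z\<epsilon>: "\<epsilon> < cmod z" and zA: "\<bar>Arg z\<bar> < \<mu>" using z by (auto simp: G_plus_def)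
  have f_eq: "?f \<zeta> = ?g \<zeta> / (\<zeta> - z) ^ Suc m" if "\<zeta> \<noteq> 0" "\<zeta> \<noteq> z" for \<zeta>
    using prabhakar_integrand_of_nat[OF that, of \<alpha> \<beta> n] \<delta>(2) m by (simp add: prabhakar_g_def)
  have cont: "continuous_on (gamma_contour \<epsilon> \<mu>) ?f"
  proof -
    have nz: "\<zeta> \<noteq> z" if "\<zeta> \<in> gamma_contour \<epsilon> \<mu>" for \<zeta>
      using that z\<epsilon> zA by (auto simp: gamma_contour_def)
    have sub: "gamma_contour \<epsilon> \<mu> \<subseteq> - \<real>\<^sub>\<le>\<^sub>0"
      using gamma_contour_slit[OF \<epsilon> \<mu>(3)] by auto
    have "continuous_on (gamma_contour \<epsilon> \<mu>) (\<lambda>\<zeta>. ?g \<zeta> / (\<zeta> - z) ^ Suc m)"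
      using nz by (intro continuous_intros continuous_on_subset[OF holomorphic_on_imp_continuous_on[OF prabhakar_g_holomorphic] sub]) auto
    then show ?thesis
      using f_eq nz gamma_contour_slit[OF \<epsilon> \<mu>(3)] by (subst continuous_on_cong[OF refl, of _ _ "\<lambda>\<zeta>. ?g \<zeta> / (\<zeta> - z) ^ Suc m"]) auto
  qed
  define b where "b = ln (cmod z + 1)"
  have "0 < cmod z + 1" by (simp add: add_nonneg_pos)
  then have b: "cmod z < exp b" by (simp add: b_def)
  have ab: "ln \<epsilon> < b" unfolding b_def using z\<epsilon> \<epsilon> by simp
  have a: "exp (ln \<epsilon>) < cmod z" using z\<epsilon> \<epsilon> by simp
  let ?r = "rectpath (Complex (ln \<epsilon>) (- \<mu>)) (Complex b \<mu>)"
  have hk: "?h w = ?k w" if "\<bar>Im w\<bar> \<le> \<mu>" "exp w \<noteq> z" for w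
    using f_eq[of "exp w"] prabhakar_integrand_exp[of w \<alpha> \<beta> \<delta> z] that \<mu>(3) by simp
  have im: "path_image ?r \<subseteq> {w. \<bar>Im w\<bar> \<le> \<mu>}"
    using ab \<mu>0 by (subst path_image_rectpath) auto
  have nzr: "exp w \<noteq> z" if "w \<in> path_image ?r" for w
    using winding_number_exp_rectpath(1)[OF \<mu>0 \<mu>(3) a b zA] that by (auto simp: path_image_compose)
  have slit: "exp w \<notin> \<real>\<^sub>\<le>\<^sub>0" if "w \<in> path_image ?r" for w
  proof -
    have "Arg (exp w) \<noteq> pi" using that im \<mu>(3) Arg_exp[of w] by force
    then show ?thesis using not_nonpos_Reals_Arg exp_not_eq_zero by blast
  qed
  have conth: "continuous_on (path_image ?r) ?h"
    using nzr slit
    by (intro continuous_intros continuous_on_compose2[OF holomorphic_on_imp_continuous_on[OF prabhakar_g_holomorphic]]) auto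
  have contk: "continuous_on (path_image ?r) ?k"
    using conth by (rule continuous_on_eq) (use hk nzr im in blast)
  note B = prabhakar_hairpin[OF \<alpha> \<mu>(1,2) \<delta>(1) b, of \<beta>]
  note sh = hairpin_shift[OF B(1) ab \<mu>0 contk]
  have "contour_integral ?r ?k = contour_integral ?r ?h"
    by (rule contour_integral_cong[OF refl]) (use hk nzr im in fastforce)
  also have "\<dots> = 2 * of_real pi * \<i> * ?D"
    by (rule contour_integral_exp_rectpath_pole[OF \<mu>0 \<mu>(3) a b zA prabhakar_g_holomorphic])
  finally have val: "2 * of_real pi * of_real \<alpha> * \<i> * ?E = hairpin ?k (ln \<epsilon>) \<mu> + 2 * of_real pi * \<i> * ?D"
    using sh(2) B(2) by (simp add: algebra_simps)
  have "Gamma (of_real \<delta>) = (fact m :: complex)"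
    using Gamma_fact[of m, where 'a = complex] \<delta>(2) m by (simp add: add.commute)
  then show ?thesis
    using prabhakar_of_hairpin_value[OF \<alpha> \<mu>0 \<mu>(3) \<epsilon> cont sh(1) val] by (simp add: m)
qed

theorem theorem4p4:
  fixes \<delta> \<alpha> \<epsilon> \<mu> :: real and \<beta> :: complex
  assumes "\<delta> > 0" and "0 < \<alpha>" and "\<alpha> < 2" and "\<epsilon> > 0"
    and "pi * \<alpha> / 2 < \<mu>" and "\<mu> < min pi (\<alpha> * pi)"
  shows "(\<forall>z \<in> G_minus \<epsilon> \<mu>.
            gamma_integrable \<epsilon> \<mu> (prabhakar_integrand \<alpha> \<beta> \<delta> z) \<and>
            prabhakar (of_real \<alpha>) \<beta> (of_real \<delta>) z =
              1 / (2 * of_real pi * of_real \<alpha> * \<i>)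
                * gamma_integral \<epsilon> \<mu> (prabhakar_integrand \<alpha> \<beta> \<delta> z)) \<and>
         (\<forall>n::nat. \<delta> = of_nat n \<longrightarrow>
            (\<forall>z \<in> G_plus \<epsilon> \<mu>.
               gamma_integrable \<epsilon> \<mu> (prabhakar_integrand \<alpha> \<beta> \<delta> z) \<and>
               prabhakar (of_real \<alpha>) \<beta> (of_real \<delta>) z =
                 1 / (2 * of_real pi * of_real \<alpha> * \<i>)
                   * gamma_integral \<epsilon> \<mu> (prabhakar_integrand \<alpha> \<beta> \<delta> z)
                 + 1 / (of_real \<alpha> * Gamma (of_real \<delta>))
                   * (deriv ^^ (n - 1)) (prabhakar_g \<alpha> \<beta> \<delta>) z))"
proof -
  have "\<mu> < pi" "\<mu> < \<alpha> * pi" using assms(6) by auto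
  then show ?thesis
    using prabhakar_G_minus[OF assms(1,2,4,5)] prabhakar_G_plus[OF assms(1) _ assms(2,4,5)] by blast
qed

end
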